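(* Suppose that: (i) $F$ is twice continuously differentiable and, for constants $0<\mu\le L<\infty$, $\|\nabla F(\theta)-\nabla F(\theta')\|_2\le L\|\theta-\theta'\|_2$ and $\langle \nabla F(\theta)-\nabla F(\theta'),\theta-\theta'\rangle\ge \mu\|\theta-\theta'\|_2^2$ for all $\theta,\theta'\in\mathbb{R}^d$; (ii) at the minimizer $\theta^*$ of $F$, the matrix $\Sigma^*=\mathbb{E}[\nabla f(\theta^*;\xi)\nabla f(\theta^*;\xi)^\top]$ is positive definite and its trace $\sigma_*^2=\mathbb{E}\|\nabla f(\theta^*;\xi)\|_2^2$ is finite; (iii) for a constant $\ell_\Xi>0$, $\mathbb{E}\|\varepsilon(\theta;\xi)-\varepsilon(\theta';\xi)\|_2^2\le \ell_\Xi^2\|\theta-\theta'\|_2^2$ for all $\theta,\theta'\in\mathbb{R}^d$. Let $\eta\in(0,\eta_{\max}]$ with $\eta_{\max}=\min\{\frac{1}{4L},\frac{\mu}{8\ell_\Xi^2}\}$, and run single-epoch ROOT-SGD from $\theta_0\in\mathbb{R}^d$ with step-size $\eta$ and burn-in period $T_0=\lceil \frac{24}{\eta\mu}\rceil$. Then for every iteration $T\ge 1$, $$\mathbb{E}\|\nabla F(\theta_T)\|_2^2\le \frac{28\,\sigma_*^2}{T}+\frac{2700\,\|\nabla F(\theta_0)\|_2^2}{\eta^2\mu^2T^2}.$$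
   Context: Let $\xi$ be a random element of a measurable space $\mathcal{X}$ with distribution $\mathbb{P}$, let $f:\mathbb{R}^d\times\mathcal{X}\to\mathbb{R}$ be differentiable in its first argument (with gradient $\nabla f$ in that argument), and let $F(\theta)=\mathbb{E}[f(\theta;\xi)]$, with $\nabla F(\theta)=\mathbb{E}[\nabla f(\theta;\xi)]$ for all $\theta$. The noise is $\varepsilon(\theta;\xi)=\nabla f(\theta;\xi)-\nabla F(\theta)$. The samples $\xi_1,\xi_2,\ldots$ are i.i.d. from $\mathbb{P}$. Single-epoch ROOT-SGD with deterministic initialization $\theta_0$, step-size $\eta>0$ and burn-in period $T_0\ge1$: set $\theta_t=\theta_0$ for $1\le t\le T_0-1$; $v_t=\frac1t\sum_{s=1}^t\nabla f(\theta_0;\xi_s)$ for $1\le t\le T_0$; $v_t=\nabla f(\theta_{t-1};\xi_t)+\frac{t-1}{t}\big(v_{t-1}-\nabla f(\theta_{t-2};\xi_t)\big)$ for $t\ge T_0+1$; and $\theta_t=\theta_{t-1}-\eta v_t$ for $t\ge T_0$. *)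

theory Defs
  imports "HOL-Probability.Probability"
begin

definition risk :: "'x measure \<Rightarrow> ('a \<Rightarrow> 'x \<Rightarrow> real) \<Rightarrow> 'a \<Rightarrow> real" where
  "risk P f \<theta> = (\<integral>x. f \<theta> x \<partial>P)"

definition noise :: "('a \<Rightarrow> 'x \<Rightarrow> 'b::real_normed_vector) \<Rightarrow> ('a \<Rightarrow> 'b) \<Rightarrow> 'a \<Rightarrow> 'x \<Rightarrow> 'b" where
  "noise gf gF \<theta> x = gf \<theta> x - gF \<theta>"

definition twice_continuously_differentiable :: "(real^'d \<Rightarrow> real) \<Rightarrow> bool" where
  "twice_continuously_differentiable g \<longleftrightarrow>
     (\<exists>(G :: real^'d \<Rightarrow> real^'d) (H :: real^'d \<Rightarrow> real^'d^'d).
        (\<forall>\<theta>. GDERIV g \<theta> :> G \<theta>) \<and>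
        (\<forall>\<theta>. (G has_derivative (\<lambda>h. H \<theta> *v h)) (at \<theta>)) \<and>
        continuous_on UNIV H)"

definition outer_product :: "real^'d \<Rightarrow> real^'d \<Rightarrow> real^'d^'d" where
  "outer_product u w = (\<chi> i j. u $ i * w $ j)"

definition positive_definite :: "real^'d^'d \<Rightarrow> bool" where
  "positive_definite A \<longleftrightarrow> transpose A = A \<and> (\<forall>x. x \<noteq> 0 \<longrightarrow> x \<bullet> (A *v x) > 0)"

text \<open>
  The sequences \<open>\<theta>\<close> and \<open>v\<close> are the iterates and gradient estimators of single-epoch ROOT-SGD
  run on the sample path \<open>x 1, x 2, \<dots>\<close>, where \<open>g \<theta> x\<close> is the stochastic gradient. For
  \<open>T0 \<ge> 1\<close> the conditions determine \<open>\<theta> t\<close> for all \<open>t\<close> and \<open>v t\<close> for all \<open>t \<ge> 1\<close>; the values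
  \<open>x 0\<close> and \<open>v 0\<close> play no role.
\<close>

definition root_sgd ::
  "('a::real_normed_vector \<Rightarrow> 'x \<Rightarrow> 'a) \<Rightarrow> real \<Rightarrow> nat \<Rightarrow> 'a \<Rightarrow> (nat \<Rightarrow> 'x) \<Rightarrow>
   (nat \<Rightarrow> 'a) \<Rightarrow> (nat \<Rightarrow> 'a) \<Rightarrow> bool" where
  "root_sgd g \<eta> T0 \<theta>0 x \<theta> v \<longleftrightarrow>
     \<theta> 0 = \<theta>0 \<and>
     (\<forall>t. 1 \<le> t \<and> t \<le> T0 - 1 \<longrightarrow> \<theta> t = \<theta>0) \<and>
     (\<forall>t. 1 \<le> t \<and> t \<le> T0 \<longrightarrow> v t = (1 / real t) *\<^sub>R (\<Sum>s=1..t. g \<theta>0 (x s))) \<and>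
     (\<forall>t\<ge>T0 + 1. v t = g (\<theta> (t - 1)) (x t)
        + (real (t - 1) / real t) *\<^sub>R (v (t - 1) - g (\<theta> (t - 2)) (x t))) \<and>
     (\<forall>t\<ge>T0. \<theta> t = \<theta> (t - 1) - \<eta> *\<^sub>R v t)"

end

theory Submission
  imports Defs
begin

text \<open>
  Write \<open>m = \<eta> * \<mu>\<close>. Given the past, \<open>t * v t\<close> and \<open>t * (v t - gF (\<theta> (t - 1)))\<close> differ from functions of the past by
  the same centred noise term, whose second moment the Lipschitz condition on the noise bounds by
  \<open>\<sigma>\<^sup>2\<close>, \<open>\<parallel>gF (\<theta> (t - 1))\<parallel>\<^sup>2\<close> and \<open>m * \<parallel>(t - 1) * v (t - 1)\<parallel>\<^sup>2\<close>. The drift of \<open>t * v t\<close> contains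
  \<open>v + gF (z - \<eta> * v) - gF z\<close>, which by co-coercivity of \<open>gF\<close> is shorter than \<open>v\<close> by a factor \<open>1 - 7 / 4 * m\<close>
  (for squared norms), and this gain absorbs the last noise contribution. So the potential
  \<open>\<Phi> t = 2 * E \<parallel>t * v t\<parallel>\<^sup>2 + 2 * E \<parallel>t * (v t - gF (\<theta> (t - 1)))\<parallel>\<^sup>2\<close> satisfies
  \<open>\<Phi> (t + 1) \<le> \<Phi> t + 16 * \<sigma>\<^sup>2 + 13 / (2 * m) * E \<parallel>gF (\<theta> t)\<parallel>\<^sup>2\<close> and
  \<open>(t + 1)\<^sup>2 * E \<parallel>gF (\<theta> t)\<parallel>\<^sup>2 \<le> \<Phi> (t + 1)\<close>. After a burn-in of length at least \<open>24 / m\<close>, substituting the second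
  inequality into the first costs only bounded factors, and \<open>\<Phi>\<close> grows at most linearly.
\<close>

subsection \<open>Gradients of smooth and strongly convex functions\<close>

lemma gderiv_along_line:
  fixes F :: "'a::real_inner \<Rightarrow> real"
  assumes "\<And>z. GDERIV F z :> G z"
  shows "((\<lambda>t. F (x + t *\<^sub>R h)) has_field_derivative (G (x + t *\<^sub>R h) \<bullet> h)) (at t)"
proof -
  have "((\<lambda>t. x + t *\<^sub>R h) has_derivative (\<lambda>s. s *\<^sub>R h)) (at t)"
    by (auto intro!: derivative_eq_intros)
  moreover have "(F has_derivative (\<lambda>k. k \<bullet> G (x + t *\<^sub>R h))) (at (x + t *\<^sub>R h))"
    using assms by (simp add: gderiv_def)
  ultimately have "((\<lambda>t. F (x + t *\<^sub>R h)) has_derivative (\<lambda>s. (s *\<^sub>R h) \<bullet> G (x + t *\<^sub>R h))) (at t)"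
    by (rule has_derivative_compose)
  thus ?thesis
    by (simp add: has_field_derivative_def inner_commute mult.commute[of _ "G _ \<bullet> _"] mult_commute_abs)
qed

text \<open>Along the segment from \<open>x\<close> to \<open>y\<close> the derivative of
  \<open>?p\<close> is the increment of \<open>G\<close> paired with \<open>?h\<close>. Monotonicity
  makes \<open>t\<close> times it nonnegative, and at \<open>t = 0\<close> it vanishes. This is the
  first-order form of convexity.\<close>

lemma monotone_gradient_lower_bound:
  fixes F :: "'a::real_inner \<Rightarrow> real"
  assumes grad: "\<And>z. GDERIV F z :> G z"
    and mono: "\<And>y z. (G y - G z) \<bullet> (y - z) \<ge> 0"
  shows "F x + G x \<bullet> (y - x) \<le> F y"
proof -
  let ?h = "y - x"
  let ?p = "\<lambda>t. F (x + t *\<^sub>R ?h) - t * (G x \<bullet> ?h)"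
  have "?p 0 \<le> ?p 1"
  proof (rule DERIV_nonneg_imp_nondecreasing[of 0 1 ?p])
    fix t :: real assume t: "0 \<le> t" "t \<le> 1"
    have "(?p has_field_derivative (G (x + t *\<^sub>R ?h) \<bullet> ?h - G x \<bullet> ?h)) (at t)"
      by (auto intro!: derivative_eq_intros gderiv_along_line[OF grad])
    moreover have "G (x + t *\<^sub>R ?h) \<bullet> ?h - G x \<bullet> ?h \<ge> 0"
    proof (cases "t = 0")
      case False
      have "t * (G (x + t *\<^sub>R ?h) \<bullet> ?h - G x \<bullet> ?h) \<ge> 0"
        using mono[of "x + t *\<^sub>R ?h" x] by (simp add: inner_diff_left)
      thus ?thesis using t False by (simp add: zero_le_mult_iff)
    qed simp
    ultimately show "\<exists>d. (?p has_field_derivative d) (at t) \<and> 0 \<le> d" by blast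
  qed simp
  thus ?thesis by simp
qed

text \<open>The descent lemma: by Cauchy-Schwarz and the Lipschitz bound, the quadratic subtracted
  in \<open>?p\<close> makes its derivative nonpositive.\<close>

lemma lipschitz_gradient_upper_bound:
  fixes F :: "'a::real_inner \<Rightarrow> real"
  assumes grad: "\<And>z. GDERIV F z :> G z"
    and smooth: "\<And>y z. norm (G y - G z) \<le> L * norm (y - z)"
  shows "F y \<le> F x + G x \<bullet> (y - x) + L / 2 * (norm (y - x))\<^sup>2"
proof -
  let ?h = "y - x"
  let ?p = "\<lambda>t. F (x + t *\<^sub>R ?h) - t * (G x \<bullet> ?h) - L / 2 * t\<^sup>2 * (norm ?h)\<^sup>2"
  have "?p 0 \<ge> ?p 1"
  proof (rule DERIV_nonpos_imp_nonincreasing[of 0 1 ?p])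
    fix t :: real assume t: "0 \<le> t" "t \<le> 1"
    have "(?p has_field_derivative (G (x + t *\<^sub>R ?h) \<bullet> ?h - G x \<bullet> ?h - L * t * (norm ?h)\<^sup>2)) (at t)"
      by (auto intro!: derivative_eq_intros gderiv_along_line[OF grad])
    moreover have "G (x + t *\<^sub>R ?h) \<bullet> ?h - G x \<bullet> ?h - L * t * (norm ?h)\<^sup>2 \<le> 0"
    proof -
      have "(G (x + t *\<^sub>R ?h) - G x) \<bullet> ?h \<le> norm (G (x + t *\<^sub>R ?h) - G x) * norm ?h"
        by (rule norm_cauchy_schwarz)
      also have "\<dots> \<le> (L * (t * norm ?h)) * norm ?h"
        using smooth[of "x + t *\<^sub>R ?h" x] t by (intro mult_right_mono) auto
      finally show ?thesis by (simp add: inner_diff_left power2_eq_square)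
    qed
    ultimately show "\<exists>d. (?p has_field_derivative d) (at t) \<and> d \<le> 0" by blast
  qed simp
  thus ?thesis by simp
qed

text \<open>The inequality \<open>half\<close> improves the tangent bound by a multiple of the
  squared gradient difference. Adding it to its copy with \<open>x\<close> and \<open>y\<close>
  exchanged cancels the values of \<open>F\<close>.\<close>

lemma gradient_cocoercive:
  fixes F :: "'a::real_inner \<Rightarrow> real"
  assumes grad: "\<And>z. GDERIV F z :> G z"
    and smooth: "\<And>y z. norm (G y - G z) \<le> L * norm (y - z)"
    and mono: "\<And>y z. (G y - G z) \<bullet> (y - z) \<ge> 0"
    and "L > 0"
  shows "(norm (G y - G x))\<^sup>2 \<le> L * ((G y - G x) \<bullet> (y - x))"
proof -
  \<comment> \<open>\<open>?w\<close> is the gradient step from \<open>y\<close> for \<open>\<lambda>z. F z - G x \<bullet> z\<close>, whose minimum is at \<open>x\<close>.\<close>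
  have half: "F x + G x \<bullet> (y - x) + 1 / (2 * L) * (norm (G y - G x))\<^sup>2 \<le> F y" for x y
  proof -
    let ?d = "G y - G x"
    let ?w = "y - (1 / L) *\<^sub>R ?d"
    have "F x + G x \<bullet> (?w - x) \<le> F ?w"
      by (rule monotone_gradient_lower_bound[OF grad mono])
    also have "\<dots> \<le> F y + G y \<bullet> (?w - y) + L / 2 * (norm (?w - y))\<^sup>2"
      by (rule lipschitz_gradient_upper_bound[OF grad smooth])
    finally have *: "F x + G x \<bullet> (?w - x) \<le> F y + G y \<bullet> (?w - y) + L / 2 * (norm (?w - y))\<^sup>2" .
    have "G y \<bullet> (?w - y) - G x \<bullet> (?w - x) = - (G x \<bullet> (y - x)) - 1 / L * (?d \<bullet> ?d)"
      by (simp add: algebra_simps inner_diff_right inner_diff_left inner_commute diff_divide_distrib add_divide_distrib)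
    moreover have "L / 2 * (norm (?w - y))\<^sup>2 = 1 / (2 * L) * (?d \<bullet> ?d)"
      using \<open>L > 0\<close> by (simp add: power_mult_distrib power2_norm_eq_inner[symmetric] power_divide)
        (simp add: power2_eq_square)
    moreover have "1 / L * (?d \<bullet> ?d) = 2 * (1 / (2 * L) * (?d \<bullet> ?d))"
      by simp
    ultimately show ?thesis
      using * unfolding power2_norm_eq_inner by linarith
  qed
  have "1 / L * (norm (G y - G x))\<^sup>2 \<le> (G y - G x) \<bullet> (y - x)"
    using half[of x y] half[of y x]
    by (simp add: inner_diff_left inner_diff_right norm_minus_commute)
  thus ?thesis
    using \<open>L > 0\<close> by (simp add: field_simps)
qed

lemma gderiv_zero_at_minimum:
  fixes F :: "'a::real_inner \<Rightarrow> real"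
  assumes "GDERIV F x :> D" and "\<And>z. F x \<le> F z"
  shows "D = 0"
proof -
  have "(\<lambda>h. h \<bullet> D) = (\<lambda>h. 0)"
    using assms by (intro differential_zero_maxmin[of x UNIV F]) (auto simp: gderiv_def)
  hence "D \<bullet> D = 0" by metis
  thus ?thesis by simp
qed

text \<open>The parallelogram law with the term \<open>(norm (x - y))\<^sup>2\<close>
  dropped.\<close>

lemma norm_add_sq_le: "(norm (x + y))\<^sup>2 \<le> 2 * (norm x)\<^sup>2 + 2 * (norm (y::'a::real_inner))\<^sup>2"
  using zero_le_power2[of "norm (x - y)"]
  by (simp add: power2_norm_eq_inner inner_add_left inner_add_right inner_diff_left inner_diff_right inner_commute)

text \<open>Young's inequality for the pair \<open>c *\<^sub>R x\<close> and \<open>y\<close>. A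
  small \<open>c\<close> keeps the factor on \<open>x\<close> close to one, at the price of a large
  factor on \<open>y\<close>.\<close>

lemma norm_add_sq_le_weighted:
  fixes x y :: "'a::real_inner"
  assumes "c > 0"
  shows "(norm (x + y))\<^sup>2 \<le> (1 + c) * (norm x)\<^sup>2 + (1 + 1 / c) * (norm y)\<^sup>2"
proof -
  have "2 * (x \<bullet> y) = 2 * ((c *\<^sub>R x) \<bullet> y) / c" using assms by simp
  also have "\<dots> \<le> ((norm (c *\<^sub>R x))\<^sup>2 + (norm y)\<^sup>2) / c"
    using assms zero_le_power2[of "norm (c *\<^sub>R x - y)"] unfolding power2_norm_eq_inner
    by (intro divide_right_mono) (auto simp: inner_diff_left inner_diff_right inner_commute)
  also have "\<dots> = c * (norm x)\<^sup>2 + 1 / c * (norm y)\<^sup>2"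
    using assms by (simp add: power_mult_distrib field_simps power2_eq_square)
  finally show ?thesis
    unfolding dot_norm by (simp add: algebra_simps)
qed

text \<open>
  Bounding \<open>G t\<close> by \<open>\<Phi> (Suc t) / (t + 1)\<^sup>2\<close> turns the recursion into one with growth factor
  about \<open>1 + q\<close> with \<open>q = 13 / (2 m (t + 1)\<^sup>2)\<close>. The correction \<open>17550 = 2700 * 13 / 2\<close> in the bound telescopes
  against the sum of these \<open>q\<close>.
\<close>

lemma potential_bound:
  fixes \<Phi> G :: "nat \<Rightarrow> real"
  assumes m: "0 < m" "m \<le> 1 / 4" and s: "0 \<le> s" and g: "0 \<le> g"
    and T0: "24 / m \<le> real T0"
    and init: "\<Phi> T0 \<le> 8 * s * real T0 + 1900 * g / m\<^sup>2"
    and step: "\<And>t. t \<ge> T0 \<Longrightarrow> \<Phi> (Suc t) \<le> \<Phi> t + 16 * s + 13 / (2 * m) * G t"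
    and G: "\<And>t. t \<ge> T0 \<Longrightarrow> (real (Suc t))\<^sup>2 * G t \<le> \<Phi> (Suc t)"
    and "t \<ge> T0"
  shows "\<Phi> t \<le> 28 * s * real t + (2700 - 17550 / (m * real t)) * g / m\<^sup>2"
  using \<open>t \<ge> T0\<close>
proof (induction t rule: dec_induct)
  case base
  have "24 \<le> m * real T0" using T0 m by (simp add: field_simps)
  \<comment> \<open>The correction is at most 731.25 here, so the bracket is at least 1968.75 and
    covers the 1900 of the initial bound.\<close>
  hence "17550 / (m * real T0) \<le> 17550 / 24"
    by (intro divide_left_mono) auto
  hence "1900 * (g / m\<^sup>2) \<le> (2700 - 17550 / (m * real T0)) * (g / m\<^sup>2)"
    using g by (intro mult_right_mono) auto
  moreover have "8 * s * real T0 \<le> 28 * s * real T0"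
    using s by (simp add: mult_right_mono)
  ultimately show ?case using init by simp
next
  case (step t)
  define n where "n = real (Suc t)"
  define q where "q = 13 / (2 * m * n\<^sup>2)"
  define h where "h = g / m\<^sup>2"
  have T0pos: "real T0 > 0" using T0 m by (smt (verit) divide_pos_pos)
  have tT: "real t \<ge> real T0" using step.hyps by simp
  have n: "n = real t + 1" "n > 0" by (auto simp: n_def)
  have mt: "24 \<le> m * real t"
  proof -
    have "24 / m \<le> real t" using T0 tT by linarith
    thus ?thesis using m by (simp add: field_simps)
  qed
  have mn: "24 \<le> m * n" using mt m by (simp add: n algebra_simps)
  have q0: "q > 0" using m n by (simp add: q_def)
  have qn: "q * n = 13 / (2 * (m * n))" using n(2) by (simp add: q_def power2_eq_square)
  \<comment> \<open>The length of the burn-in enters here: it keeps the relative loss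
    \<open>q * n\<close> below one third.\<close>
  have "13 / (2 * (m * n)) \<le> 13 / (2 * 24)"
    using mn by (intro divide_left_mono) auto
  hence qn_le: "q * n \<le> 13 / 48" using qn by simp
  have "1 * q \<le> n * q" using n q0 by (intro mult_right_mono) auto
  hence q1: "q < 1" using qn_le by (simp add: mult.commute)
  have h0: "h \<ge> 0" using g by (simp add: h_def)
  have "G t \<le> \<Phi> (Suc t) / n\<^sup>2"
    using assms(8)[of t] step.hyps n by (simp add: n_def field_simps)
  hence "13 / (2 * m) * G t \<le> 13 / (2 * m) * (\<Phi> (Suc t) / n\<^sup>2)"
    using m by (intro mult_left_mono) auto
  also have "\<dots> = q * \<Phi> (Suc t)" by (simp add: q_def)
  finally have "\<Phi> (Suc t) \<le> \<Phi> t + 16 * s + q * \<Phi> (Suc t)"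
    using assms(7)[of t] step.hyps by simp
  hence A: "(1 - q) * \<Phi> (Suc t) \<le> 28 * s * real t + (2700 - 17550 / (m * real t)) * h + 16 * s"
    using step.IH unfolding h_def left_diff_distrib[of 1 q] times_divide_eq_right by linarith
  \<comment> \<open>One step adds \<open>16 * s\<close> to the recursion while the bound grows by
    \<open>28 * s\<close>. The spare \<open>12 * s\<close> pays for the loss
    \<open>28 * s * (q * n)\<close>, which is below \<open>8 * s\<close>.\<close>
  have "28 * s * real t + 16 * s \<le> (1 - q) * (28 * s * n)"
  proof -
    have "28 * (q * n) \<le> 12" using qn_le by linarith
    hence "s * (28 * (q * n)) \<le> s * 12" using s by (rule mult_left_mono)
    thus ?thesis by (simp add: n algebra_simps)
  qed
  moreover have "(2700 - 17550 / (m * real t)) * h \<le> (1 - q) * ((2700 - 17550 / (m * n)) * h)"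
  proof -
    \<comment> \<open>In one step \<open>1 / t\<close> drops by \<open>1 / (t * n)\<close>, at least
      \<open>1 / n\<^sup>2\<close>. Scaled by \<open>17550 / m\<close> this covers the
      \<open>2700 * q\<close> taken away by the factor \<open>1 - q\<close>.\<close>
    have "17550 / (m * real t) - 17550 / (m * n) = 17550 * (n - real t) / (m * real t * n)"
      using m(1) n(2) less_le_trans[OF T0pos tT] by (simp add: field_simps)
    also have "\<dots> = 17550 / (m * real t * n)" by (simp add: n(1))
    also have "\<dots> \<ge> 17550 / (m * n * n)"
      using m n tT T0pos by (intro divide_left_mono mult_right_mono) auto
    also (xtrans) have "17550 / (m * n * n) = 2700 * q" by (simp add: q_def power2_eq_square)
    finally have "17550 / (m * real t) - 17550 / (m * n) \<ge> 2700 * q" .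
    moreover have "q * (17550 / (m * n)) \<ge> 0" using q0 m n by simp
    moreover have "(1 - q) * (2700 - k) = 2700 - k - 2700 * q + q * k" for k
      by (simp add: algebra_simps)
    ultimately have "2700 - 17550 / (m * real t) \<le> (1 - q) * (2700 - 17550 / (m * n))"
      by simp
    hence "(2700 - 17550 / (m * real t)) * h \<le> ((1 - q) * (2700 - 17550 / (m * n))) * h"
      using h0 by (rule mult_right_mono)
    thus ?thesis by (simp add: mult.assoc)
  qed
  ultimately have "(1 - q) * \<Phi> (Suc t) \<le> (1 - q) * (28 * s * n + (2700 - 17550 / (m * n)) * h)"
    using A by (simp add: distrib_left)
  thus ?case using q1 by (simp add: n_def h_def)
qed

subsection \<open>Independent samples and functions of the past\<close>

text \<open>The simple functions \<open>q i\<close> tend to the identity. Replacing \<open>z\<close>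
  by \<open>q i z\<close> leaves finitely many measurable slices, and continuity in \<open>z\<close>
  recovers \<open>f\<close> as the pointwise limit.\<close>

lemma borel_measurable_caratheodory:
  fixes f :: "'a::{metric_space, second_countable_topology} \<Rightarrow> 'x \<Rightarrow> 'b::metric_space"
  assumes meas: "\<And>z. f z \<in> borel_measurable P"
    and cont: "\<And>x. x \<in> space P \<Longrightarrow> continuous_on UNIV (\<lambda>z. f z x)"
  shows "(\<lambda>(z, x). f z x) \<in> borel_measurable (borel \<Otimes>\<^sub>M P)"
proof -
  obtain q :: "nat \<Rightarrow> 'a \<Rightarrow> 'a" where q: "\<And>i. simple_function borel (q i)"
    and lim: "\<And>z. (\<lambda>i. q i z) \<longlonglongrightarrow> z"
    using borel_measurable_implies_sequence_metric[of "\<lambda>z. z" "borel :: 'a measure" undefined] by auto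
  have "(\<lambda>p. f (q i (fst p)) (snd p)) \<in> borel_measurable (borel \<Otimes>\<^sub>M P)" for i
  proof (rule measurable_compose_countable'[where f = "\<lambda>z p. f z (snd p)" and I = "range (q i)"])
    show "(\<lambda>p. f z (snd p)) \<in> borel_measurable (borel \<Otimes>\<^sub>M P)" for z
      using meas[of z] by measurable
    have "finite (range (q i))" using simple_functionD(1)[OF q[of i]] by simp
    thus "countable (range (q i))" by (rule countable_finite)
    have "q i \<in> measurable borel (count_space (range (q i)))"
      using \<open>finite (range (q i))\<close> simple_functionD(2)[OF q[of i]] by (simp add: measurable_count_space_eq2)
    thus "(\<lambda>p. q i (fst p)) \<in> measurable (borel \<Otimes>\<^sub>M P) (count_space (range (q i)))"
      by measurable
  qed
  moreover have "(\<lambda>i. f (q i (fst p)) (snd p)) \<longlonglongrightarrow> (case p of (z, x) \<Rightarrow> f z x)"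
    if "p \<in> space (borel \<Otimes>\<^sub>M P)" for p
  proof -
    have "isCont (\<lambda>z. f z (snd p)) (fst p)"
      using that cont[of "snd p"] by (auto simp: space_pair_measure continuous_on_eq_continuous_at)
    from isCont_tendsto_compose[OF this lim] show ?thesis by (simp add: case_prod_beta)
  qed
  ultimately show ?thesis
    by (rule borel_measurable_LIMSEQ_metric)
qed

lemma gderiv_isCont: "GDERIV f z :> g \<Longrightarrow> isCont f z"
  unfolding gderiv_def by (rule has_derivative_continuous)

text \<open>Differentiability makes \<open>f\<close> continuous in the parameter, hence jointly
  measurable. Each component of the gradient is then a pointwise limit of difference quotients with
  increments \<open>1 / (n + 1)\<close>.\<close>

lemma borel_measurable_gradient:
  fixes f :: "'a::euclidean_space \<Rightarrow> 'x \<Rightarrow> real" and gf :: "'a \<Rightarrow> 'x \<Rightarrow> 'a"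
  assumes meas: "\<And>z. f z \<in> borel_measurable P"
    and grad: "\<And>z x. x \<in> space P \<Longrightarrow> GDERIV (\<lambda>y. f y x) z :> gf z x"
  shows "(\<lambda>(z, x). gf z x) \<in> borel_measurable (borel \<Otimes>\<^sub>M P)"
proof -
  have F: "(\<lambda>(z, x). f z x) \<in> borel_measurable (borel \<Otimes>\<^sub>M P)"
    by (intro borel_measurable_caratheodory meas)
       (auto simp: continuous_on_eq_continuous_at intro: gderiv_isCont grad)
  have shift: "(\<lambda>p. f (fst p + c) (snd p)) \<in> borel_measurable (borel \<Otimes>\<^sub>M P)" for c
  proof -
    have "(\<lambda>p. (fst p + c, snd p)) \<in> measurable (borel \<Otimes>\<^sub>M P) (borel \<Otimes>\<^sub>M P)"
      by measurable
    from measurable_compose[OF this F] show ?thesis by simp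
  qed
  have "(\<lambda>p. gf (fst p) (snd p) \<bullet> b) \<in> borel_measurable (borel \<Otimes>\<^sub>M P)" for b
  proof (rule borel_measurable_LIMSEQ_metric)
    fix p :: "'a \<times> 'x" assume "p \<in> space (borel \<Otimes>\<^sub>M P)"
    hence "snd p \<in> space P" by (auto simp: space_pair_measure)
    from gderiv_along_line[of "\<lambda>y. f y (snd p)" "\<lambda>z. gf z (snd p)" "fst p" b 0, OF grad[OF this]]
    have "(\<lambda>h. (f (fst p + h *\<^sub>R b) (snd p) - f (fst p) (snd p)) / h) \<midarrow>0\<rightarrow> gf (fst p) (snd p) \<bullet> b"
      by (simp add: DERIV_def)
    moreover have "filterlim (\<lambda>n. inverse (real (Suc n))) (at 0) sequentially"
      using LIMSEQ_inverse_real_of_nat by (auto simp: filterlim_at)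
    ultimately show "(\<lambda>n. (f (fst p + inverse (real (Suc n)) *\<^sub>R b) (snd p) - f (fst p) (snd p))
        / inverse (real (Suc n))) \<longlonglongrightarrow> gf (fst p) (snd p) \<bullet> b"
      by (rule filterlim_compose)
  qed (intro borel_measurable_divide borel_measurable_diff borel_measurable_const shift shift[of 0, simplified])
  thus ?thesis
    by (subst borel_measurable_euclidean_space) (simp add: case_prod_beta)
qed

section \<open>Independent samples and dependence on the first \<open>t\<close> of them\<close>

locale iid_samples = prob_space M for M :: "'w measure" +
  fixes P :: "'x measure" and \<xi> :: "nat \<Rightarrow> 'w \<Rightarrow> 'x"
  assumes indep: "indep_vars (\<lambda>_. P) \<xi> {1..}"
    and distr: "\<And>t. t \<ge> 1 \<Longrightarrow> distr M P (\<xi> t) = P"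
begin

lemma measurable_sample: "t \<ge> 1 \<Longrightarrow> \<xi> t \<in> measurable M P"
  using indep by (auto simp: indep_vars_def)

lemma prob_space_sample: "prob_space P"
  using prob_space_distr[OF measurable_sample[of 1]] distr[of 1] by simp

text \<open>Takes the place of measurability for the sigma-algebra of the first \<open>t\<close>
  samples. The explicit factor \<open>h\<close> lets independence of the samples be carried over to
  \<open>Y\<close>. Agreement is asked for on \<open>space M\<close> only, where the recursion of
  the iterates is given.\<close>

definition past_measurable :: "nat \<Rightarrow> ('w \<Rightarrow> 'b::topological_space) \<Rightarrow> bool" where
  "past_measurable t Y \<longleftrightarrow> (\<exists>h \<in> borel_measurable (Pi\<^sub>M {1..t} (\<lambda>_. P)).
     \<forall>\<omega>\<in>space M. Y \<omega> = h (restrict (\<lambda>i. \<xi> i \<omega>) {1..t}))"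

lemma measurable_past: "(\<lambda>\<omega>. restrict (\<lambda>i. \<xi> i \<omega>) {1..t}) \<in> measurable M (Pi\<^sub>M {1..t} (\<lambda>_. P))"
  by (intro measurable_restrict measurable_sample) simp

lemma past_measurable_borel:
  assumes "past_measurable t Y"
  shows "Y \<in> borel_measurable M"
proof -
  obtain h where h: "h \<in> borel_measurable (Pi\<^sub>M {1..t} (\<lambda>_. P))"
    "\<And>\<omega>. \<omega> \<in> space M \<Longrightarrow> Y \<omega> = h (restrict (\<lambda>i. \<xi> i \<omega>) {1..t})"
    using assms by (auto simp: past_measurable_def)
  have "(\<lambda>\<omega>. h (restrict (\<lambda>i. \<xi> i \<omega>) {1..t})) \<in> borel_measurable M"
    by (rule measurable_compose[OF measurable_past h(1)])
  thus ?thesis using h(2) by (simp cong: measurable_cong)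
qed

lemma past_measurable_cong:
  assumes "past_measurable t Y" "\<And>\<omega>. \<omega> \<in> space M \<Longrightarrow> Y \<omega> = Z \<omega>"
  shows "past_measurable t Z"
  using assms by (auto simp: past_measurable_def)

lemma past_measurable_const: "past_measurable t (\<lambda>_. c)"
  unfolding past_measurable_def by (intro bexI[of _ "\<lambda>_. c"]) auto

lemma past_measurable_compose:
  assumes "past_measurable t Y" "\<phi> \<in> borel_measurable borel"
  shows "past_measurable t (\<lambda>\<omega>. \<phi> (Y \<omega>))"
proof -
  obtain h where h: "h \<in> borel_measurable (Pi\<^sub>M {1..t} (\<lambda>_. P))"
    "\<And>\<omega>. \<omega> \<in> space M \<Longrightarrow> Y \<omega> = h (restrict (\<lambda>i. \<xi> i \<omega>) {1..t})"
    using assms by (auto simp: past_measurable_def)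
  show ?thesis unfolding past_measurable_def
    by (rule bexI[OF _ measurable_compose[OF h(1) assms(2)]]) (simp add: h(2))
qed

lemma past_measurable_Pair:
  fixes Y :: "'w \<Rightarrow> 'b::second_countable_topology" and Z :: "'w \<Rightarrow> 'c::second_countable_topology"
  assumes "past_measurable t Y" "past_measurable t Z"
  shows "past_measurable t (\<lambda>\<omega>. (Y \<omega>, Z \<omega>))"
proof -
  obtain h k where h: "h \<in> borel_measurable (Pi\<^sub>M {1..t} (\<lambda>_. P))"
    "\<And>\<omega>. \<omega> \<in> space M \<Longrightarrow> Y \<omega> = h (restrict (\<lambda>i. \<xi> i \<omega>) {1..t})"
    and k: "k \<in> borel_measurable (Pi\<^sub>M {1..t} (\<lambda>_. P))"
    "\<And>\<omega>. \<omega> \<in> space M \<Longrightarrow> Z \<omega> = k (restrict (\<lambda>i. \<xi> i \<omega>) {1..t})"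
    using assms by (auto simp: past_measurable_def)
  show ?thesis unfolding past_measurable_def
    by (rule bexI[OF _ borel_measurable_Pair[OF h(1) k(1)]]) (simp add: h(2) k(2))
qed

lemma past_measurable_mono:
  assumes "past_measurable s Y" "s \<le> t"
  shows "past_measurable t Y"
proof -
  obtain h where h: "h \<in> borel_measurable (Pi\<^sub>M {1..s} (\<lambda>_. P))"
    "\<And>\<omega>. \<omega> \<in> space M \<Longrightarrow> Y \<omega> = h (restrict (\<lambda>i. \<xi> i \<omega>) {1..s})"
    using assms by (auto simp: past_measurable_def)
  have sub: "{1..s} \<subseteq> {1..t}" using assms(2) by auto
  have "(\<lambda>x. restrict x {1..s}) \<in> measurable (Pi\<^sub>M {1..t} (\<lambda>_. P)) (Pi\<^sub>M {1..s} (\<lambda>_. P))"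
    by (rule measurable_restrict_subset[OF sub])
  hence "(\<lambda>x. h (restrict x {1..s})) \<in> borel_measurable (Pi\<^sub>M {1..t} (\<lambda>_. P))"
    by (rule measurable_compose[OF _ h(1)])
  thus ?thesis unfolding past_measurable_def
    by (rule bexI[rotated]) (use assms(2) in \<open>simp add: h(2) min_absorb2\<close>)
qed

text \<open>The factor of \<open>Y\<close> is extended to \<open>Suc t\<close> coordinates and
  paired with the last one. This is how an update with a fresh sample moves adaptedness forward by
  one index.\<close>

lemma past_measurable_sample:
  assumes "past_measurable t Y" "\<phi> \<in> borel_measurable (borel \<Otimes>\<^sub>M P)"
  shows "past_measurable (Suc t) (\<lambda>\<omega>. \<phi> (Y \<omega>, \<xi> (Suc t) \<omega>))"
proof -
  obtain h where h: "h \<in> borel_measurable (Pi\<^sub>M {1..Suc t} (\<lambda>_. P))"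
    "\<And>\<omega>. \<omega> \<in> space M \<Longrightarrow> Y \<omega> = h (restrict (\<lambda>i. \<xi> i \<omega>) {1..Suc t})"
    using past_measurable_mono[OF assms(1), of "Suc t"] by (auto simp: past_measurable_def)
  have "(\<lambda>x. (h x, x (Suc t))) \<in> measurable (Pi\<^sub>M {1..Suc t} (\<lambda>_. P)) (borel \<Otimes>\<^sub>M P)"
    using h(1) by measurable
  from measurable_compose[OF this assms(2)] show ?thesis unfolding past_measurable_def
    by (rule bexI[rotated]) (simp add: h(2))
qed

text \<open>\<open>Y\<close> depends on the block \<open>{1..t}\<close> of samples, the new sample
  is the block \<open>{Suc t}\<close>. Disjoint blocks of independent variables have a product law,
  which is pushed forward to the pair.\<close>

lemma distr_past_sample:
  fixes Y :: "'w \<Rightarrow> 'b::topological_space"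
  assumes "past_measurable t Y"
  shows "distr M (borel \<Otimes>\<^sub>M P) (\<lambda>\<omega>. (Y \<omega>, \<xi> (Suc t) \<omega>)) = distr M borel Y \<Otimes>\<^sub>M P"
proof -
  obtain h where h: "h \<in> borel_measurable (Pi\<^sub>M {1..t} (\<lambda>_. P))"
    "\<And>\<omega>. \<omega> \<in> space M \<Longrightarrow> Y \<omega> = h (restrict (\<lambda>i. \<xi> i \<omega>) {1..t})"
    using assms by (auto simp: past_measurable_def)
  let ?A = "Pi\<^sub>M {1..t} (\<lambda>_. P)" and ?B = "Pi\<^sub>M {Suc t} (\<lambda>_. P)"
  let ?X = "\<lambda>\<omega>. restrict (\<lambda>i. \<xi> i \<omega>) {1..t}" and ?W = "\<lambda>\<omega>. restrict (\<lambda>i. \<xi> i \<omega>) {Suc t}"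
  let ?Z = "\<lambda>\<omega>. h (?X \<omega>)"
  interpret P: prob_space P by (rule prob_space_sample)
  have "indep_var ?A ?X ?B ?W"
    by (rule indep_var_restrict[OF indep]) auto
  hence X: "?X \<in> measurable M ?A" and W: "?W \<in> measurable M ?B"
    and pair: "distr M (?A \<Otimes>\<^sub>M ?B) (\<lambda>\<omega>. (?X \<omega>, ?W \<omega>)) = distr M ?A ?X \<Otimes>\<^sub>M distr M ?B ?W"
    by (simp_all add: indep_var_distribution_eq)
  have proj: "(\<lambda>x. x (Suc t)) \<in> measurable ?B P"
    by measurable
  have last: "distr (distr M ?B ?W) P (\<lambda>x. x (Suc t)) = P"
    by (subst distr_distr[OF proj W]) (simp add: comp_def distr)
  have "distr M (borel \<Otimes>\<^sub>M P) (\<lambda>\<omega>. (?Z \<omega>, \<xi> (Suc t) \<omega>))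
      = distr (distr M (?A \<Otimes>\<^sub>M ?B) (\<lambda>\<omega>. (?X \<omega>, ?W \<omega>))) (borel \<Otimes>\<^sub>M P) (\<lambda>(x, y). (h x, y (Suc t)))"
    by (subst distr_distr) (use h(1) proj X W in \<open>auto simp: comp_def\<close>)
  also have "\<dots> = distr (distr M ?A ?X) borel h \<Otimes>\<^sub>M distr (distr M ?B ?W) P (\<lambda>x. x (Suc t))"
    unfolding pair using h(1) proj
    by (intro pair_measure_distr[symmetric]) (auto simp: last P.sigma_finite_measure_axioms)
  also have "\<dots> = distr M borel ?Z \<Otimes>\<^sub>M P"
    unfolding last by (subst distr_distr[OF h(1) X]) (simp add: comp_def)
  finally have "distr M (borel \<Otimes>\<^sub>M P) (\<lambda>\<omega>. (?Z \<omega>, \<xi> (Suc t) \<omega>)) = distr M borel ?Z \<Otimes>\<^sub>M P" .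
  moreover have "distr M borel ?Z = distr M borel Y"
    by (rule distr_cong) (auto simp: h(2))
  moreover have "distr M (borel \<Otimes>\<^sub>M P) (\<lambda>\<omega>. (?Z \<omega>, \<xi> (Suc t) \<omega>))
      = distr M (borel \<Otimes>\<^sub>M P) (\<lambda>\<omega>. (Y \<omega>, \<xi> (Suc t) \<omega>))"
    by (rule distr_cong) (auto simp: h(2))
  ultimately show ?thesis by simp
qed

text \<open>For fixed \<open>y\<close> the noise \<open>e y\<close> is centred, so the cross term of
  the square vanishes; the product law of past and new sample replaces conditioning. The bound
  \<open>c\<close> stands in for the exact variance, so that only \<open>c\<close> has to be
  integrated along the run.\<close>

proposition second_moment_increment:
  fixes Y :: "'w \<Rightarrow> 'b::topological_space" and a :: "'b \<Rightarrow> 'a::euclidean_space"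
  assumes past: "past_measurable t Y"
    and a: "a \<in> borel_measurable borel"
    and e: "(\<lambda>(y, x). e y x) \<in> borel_measurable (borel \<Otimes>\<^sub>M P)"
    and e_int: "\<And>y. integrable P (e y)" and e_mean: "\<And>y. (\<integral>x. e y x \<partial>P) = 0"
    and e_sq: "\<And>y. integrable P (\<lambda>x. (norm (e y x))\<^sup>2)"
    and e_le: "\<And>y. (\<integral>x. (norm (e y x))\<^sup>2 \<partial>P) \<le> c y"
    and c: "c \<in> borel_measurable borel"
    and a_int: "integrable M (\<lambda>\<omega>. (norm (a (Y \<omega>)))\<^sup>2)"
    and c_int: "integrable M (\<lambda>\<omega>. c (Y \<omega>))"
  shows "integrable M (\<lambda>\<omega>. (norm (a (Y \<omega>) + e (Y \<omega>) (\<xi> (Suc t) \<omega>)))\<^sup>2)"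
    and "(\<integral>\<omega>. (norm (a (Y \<omega>) + e (Y \<omega>) (\<xi> (Suc t) \<omega>)))\<^sup>2 \<partial>M)
      \<le> (\<integral>\<omega>. (norm (a (Y \<omega>)))\<^sup>2 \<partial>M) + (\<integral>\<omega>. c (Y \<omega>) \<partial>M)"
proof -
  interpret P: prob_space P by (rule prob_space_sample)
  note [measurable] = a e c past_measurable_borel[OF past] measurable_sample[of "Suc t", simplified]
  have c0: "0 \<le> c y" for y
    by (rule order_trans[OF _ e_le]) simp
  let ?b = "(\<integral>\<omega>. (norm (a (Y \<omega>)))\<^sup>2 \<partial>M) + (\<integral>\<omega>. c (Y \<omega>) \<partial>M)"
  have em: "(\<lambda>p. e (fst p) (snd p)) \<in> borel_measurable (borel \<Otimes>\<^sub>M P)"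
    using e by (simp add: case_prod_beta)
  note [measurable] = em
  have inner: "(\<integral>\<^sup>+x. ennreal ((norm (a y + e y x))\<^sup>2) \<partial>P) \<le> ennreal ((norm (a y))\<^sup>2 + c y)" for y
  proof -
    have eq: "(\<lambda>x. (norm (a y + e y x))\<^sup>2) = (\<lambda>x. (norm (a y))\<^sup>2 + 2 * (a y \<bullet> e y x) + (norm (e y x))\<^sup>2)"
      by (auto simp: power2_norm_eq_inner inner_add_left inner_add_right inner_commute)
    have int: "integrable P (\<lambda>x. a y \<bullet> e y x)" using e_int[of y] by simp
    have "integrable P (\<lambda>x. (norm (a y + e y x))\<^sup>2)"
      unfolding eq using int e_sq[of y] by simp
    hence "(\<integral>\<^sup>+x. ennreal ((norm (a y + e y x))\<^sup>2) \<partial>P) = ennreal (\<integral>x. (norm (a y + e y x))\<^sup>2 \<partial>P)"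
      by (intro nn_integral_eq_integral) auto
    also have "(\<integral>x. (norm (a y + e y x))\<^sup>2 \<partial>P) = (norm (a y))\<^sup>2 + (\<integral>x. (norm (e y x))\<^sup>2 \<partial>P)"
      unfolding eq using int e_int[of y] e_sq[of y] e_mean[of y] by (simp add: P.prob_space)
    also have "ennreal \<dots> \<le> ennreal ((norm (a y))\<^sup>2 + c y)"
      using e_le[of y] by (intro ennreal_leI) simp
    finally show ?thesis .
  qed
  \<comment> \<open>Nonnegative integrals come first: Tonelli asks for no integrability of the left
    side, which is itself part of the conclusion.\<close>
  have "(\<integral>\<^sup>+\<omega>. ennreal ((norm (a (Y \<omega>) + e (Y \<omega>) (\<xi> (Suc t) \<omega>)))\<^sup>2) \<partial>M)
      = (\<integral>\<^sup>+p. ennreal ((norm (a (fst p) + e (fst p) (snd p)))\<^sup>2) \<partial>distr M (borel \<Otimes>\<^sub>M P) (\<lambda>\<omega>. (Y \<omega>, \<xi> (Suc t) \<omega>)))"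
    by (subst nn_integral_distr) simp_all
  also have "\<dots> = (\<integral>\<^sup>+y. \<integral>\<^sup>+x. ennreal ((norm (a y + e y x))\<^sup>2) \<partial>P \<partial>distr M borel Y)"
    unfolding distr_past_sample[OF past] by (subst P.nn_integral_fst[symmetric]) simp_all
  also have "\<dots> \<le> (\<integral>\<^sup>+y. ennreal ((norm (a y))\<^sup>2 + c y) \<partial>distr M borel Y)"
    by (intro nn_integral_mono inner)
  also have "\<dots> = (\<integral>\<^sup>+\<omega>. ennreal ((norm (a (Y \<omega>)))\<^sup>2 + c (Y \<omega>)) \<partial>M)"
    by (subst nn_integral_distr) simp_all
  also have "\<dots> = ennreal (\<integral>\<omega>. (norm (a (Y \<omega>)))\<^sup>2 + c (Y \<omega>) \<partial>M)"
    using a_int c_int c0 by (intro nn_integral_eq_integral) auto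
  also have "\<dots> = ennreal ?b" using a_int c_int by simp
  finally have nn: "(\<integral>\<^sup>+\<omega>. ennreal ((norm (a (Y \<omega>) + e (Y \<omega>) (\<xi> (Suc t) \<omega>)))\<^sup>2) \<partial>M) \<le> ennreal ?b" .
  have meas: "(\<lambda>\<omega>. (norm (a (Y \<omega>) + e (Y \<omega>) (\<xi> (Suc t) \<omega>)))\<^sup>2) \<in> borel_measurable M"
    by measurable
  show int: "integrable M (\<lambda>\<omega>. (norm (a (Y \<omega>) + e (Y \<omega>) (\<xi> (Suc t) \<omega>)))\<^sup>2)"
    using nn by (intro integrableI_nonneg meas) (auto simp: order_le_less_trans)
  have "ennreal (\<integral>\<omega>. (norm (a (Y \<omega>) + e (Y \<omega>) (\<xi> (Suc t) \<omega>)))\<^sup>2 \<partial>M) \<le> ennreal ?b"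
    using nn nn_integral_eq_integral[OF int] by simp
  moreover have "0 \<le> ?b" using c0 by simp
  ultimately show "(\<integral>\<omega>. (norm (a (Y \<omega>) + e (Y \<omega>) (\<xi> (Suc t) \<omega>)))\<^sup>2 \<partial>M) \<le> ?b"
    by simp
qed

end

subsection \<open>Second moments along the run\<close>

definition square_integrable :: "'w measure \<Rightarrow> ('w \<Rightarrow> 'a::euclidean_space) \<Rightarrow> bool" where
  "square_integrable M X \<longleftrightarrow> X \<in> borel_measurable M \<and> integrable M (\<lambda>\<omega>. (norm (X \<omega>))\<^sup>2)"

lemma square_integrable_bound:
  assumes "square_integrable M X" "Y \<in> borel_measurable M"
    and "\<And>\<omega>. \<omega> \<in> space M \<Longrightarrow> norm (Y \<omega>) \<le> C * norm (X \<omega>)"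
  shows "square_integrable M Y"
proof -
  have "integrable M (\<lambda>\<omega>. (norm (Y \<omega>))\<^sup>2)"
  proof (rule Bochner_Integration.integrable_bound)
    show "integrable M (\<lambda>\<omega>. C\<^sup>2 * (norm (X \<omega>))\<^sup>2)"
      using assms(1) by (simp add: square_integrable_def)
    show "AE \<omega> in M. norm ((norm (Y \<omega>))\<^sup>2) \<le> norm (C\<^sup>2 * (norm (X \<omega>))\<^sup>2)"
      using assms(3) by (intro AE_I2) (auto simp flip: power_mult_distrib intro!: power_mono)
  qed (use assms(2) in measurable)
  thus ?thesis using assms(2) by (simp add: square_integrable_def)
qed

lemma square_integrable_add:
  assumes "square_integrable M X" "square_integrable M Y"
  shows "square_integrable M (\<lambda>\<omega>. X \<omega> + Y \<omega>)"
proof -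
  have [measurable]: "X \<in> borel_measurable M" "Y \<in> borel_measurable M"
    using assms by (auto simp: square_integrable_def)
  have "integrable M (\<lambda>\<omega>. (norm (X \<omega> + Y \<omega>))\<^sup>2)"
  proof (rule Bochner_Integration.integrable_bound)
    show "integrable M (\<lambda>\<omega>. 2 * (norm (X \<omega>))\<^sup>2 + 2 * (norm (Y \<omega>))\<^sup>2)"
      using assms by (simp add: square_integrable_def)
    show "AE \<omega> in M. norm ((norm (X \<omega> + Y \<omega>))\<^sup>2) \<le> norm (2 * (norm (X \<omega>))\<^sup>2 + 2 * (norm (Y \<omega>))\<^sup>2)"
      using norm_add_sq_le[of "X _" "Y _"] by (intro AE_I2) simp
  qed measurable
  thus ?thesis by (simp add: square_integrable_def)
qed

lemma square_integrable_scaleR: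
  "square_integrable M X \<Longrightarrow> square_integrable M (\<lambda>\<omega>. c *\<^sub>R X \<omega>)"
  by (auto simp: square_integrable_def power_mult_distrib)

lemma square_integrable_diff:
  assumes "square_integrable M X" "square_integrable M Y"
  shows "square_integrable M (\<lambda>\<omega>. X \<omega> - Y \<omega>)"
  using square_integrable_add[OF assms(1) square_integrable_scaleR[OF assms(2), of "-1"]] by simp

lemma square_integrable_cong:
  "square_integrable M X \<Longrightarrow> (\<And>\<omega>. \<omega> \<in> space M \<Longrightarrow> X \<omega> = Y \<omega>) \<Longrightarrow> square_integrable M Y"
  unfolding square_integrable_def
  by (auto cong: measurable_cong Bochner_Integration.integrable_cong)

lemma (in finite_measure) square_integrable_const: "square_integrable M (\<lambda>_. c)"
  by (simp add: square_integrable_def)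

section \<open>One run of ROOT-SGD: constants, measurability and noise\<close>

locale root_sgd_run = iid_samples M P \<xi>
  for M :: "'w measure" and P :: "'x measure" and \<xi> :: "nat \<Rightarrow> 'w \<Rightarrow> 'x" +
  fixes f :: "'a::euclidean_space \<Rightarrow> 'x \<Rightarrow> real" and gf :: "'a \<Rightarrow> 'x \<Rightarrow> 'a" and gF :: "'a \<Rightarrow> 'a"
    and \<theta>s \<theta>0 :: 'a and \<mu> L lXi \<eta> :: real
    and \<theta> v :: "nat \<Rightarrow> 'w \<Rightarrow> 'a" and T0 :: nat
  assumes f_integrable: "\<And>z. integrable P (f z)"
    and f_grad: "\<And>z x. x \<in> space P \<Longrightarrow> GDERIV (\<lambda>y. f y x) z :> gf z x"
    and F_grad: "\<And>z. GDERIV (risk P f) z :> gF z"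
    and gf_integrable: "\<And>z. integrable P (gf z)"
    and gF_eq: "\<And>z. gF z = (\<integral>x. gf z x \<partial>P)"
    and mu_pos: "0 < \<mu>" and mu_le: "\<mu> \<le> L"
    and smooth: "\<And>y z. norm (gF y - gF z) \<le> L * norm (y - z)"
    and strong: "\<And>y z. (gF y - gF z) \<bullet> (y - z) \<ge> \<mu> * (norm (y - z))\<^sup>2"
    and minimizer: "\<And>z. risk P f \<theta>s \<le> risk P f z"
    and sigma_finite: "integrable P (\<lambda>x. (norm (gf \<theta>s x))\<^sup>2)"
    and lXi_pos: "0 < lXi"
    and noise_integrable:
      "\<And>y z. integrable P (\<lambda>x. (norm (noise gf gF y x - noise gf gF z x))\<^sup>2)"
    and noise_lipschitz:
      "\<And>y z. (\<integral>x. (norm (noise gf gF y x - noise gf gF z x))\<^sup>2 \<partial>P)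
              \<le> lXi\<^sup>2 * (norm (y - z))\<^sup>2"
    and eta_pos: "0 < \<eta>" and eta_le: "\<eta> \<le> min (1 / (4 * L)) (\<mu> / (8 * lXi\<^sup>2))"
    and T0_eq: "T0 = nat \<lceil>24 / (\<eta> * \<mu>)\<rceil>"
    and run: "\<And>\<omega>. \<omega> \<in> space M \<Longrightarrow>
      root_sgd gf \<eta> T0 \<theta>0 (\<lambda>t. \<xi> t \<omega>) (\<lambda>t. \<theta> t \<omega>) (\<lambda>t. v t \<omega>)"
begin

sublocale P: prob_space P by (rule prob_space_sample)

abbreviation "\<epsilon> \<equiv> noise gf gF"
abbreviation "m \<equiv> \<eta> * \<mu>"
abbreviation "\<sigma>2 \<equiv> (\<integral>x. (norm (gf \<theta>s x))\<^sup>2 \<partial>P)"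

lemma L_pos: "0 < L" using mu_pos mu_le by simp

lemma m_pos: "0 < m" using eta_pos mu_pos by simp

lemma eta_L_le: "\<eta> * L \<le> 1 / 4"
  using eta_le L_pos by (simp add: field_simps)

lemma m_le: "m \<le> 1 / 4"
  using eta_L_le mult_left_mono[OF mu_le, of \<eta>] eta_pos by linarith

text \<open>The second entry of the step-size cap in the form used below: a move by
  \<open>\<eta> *\<^sub>R u\<close> causes a squared noise change of at most
  \<open>m / 8 * (norm u)\<^sup>2\<close> in mean.\<close>

lemma eta_lXi_le: "8 * \<eta> * lXi\<^sup>2 \<le> \<mu>"
  using eta_le lXi_pos by (simp add: field_simps)

lemma gF_minimizer: "gF \<theta>s = 0"
  by (rule gderiv_zero_at_minimum[OF F_grad minimizer])

lemma norm_gF_le: "norm (gF z) \<le> L * norm (z - \<theta>s)"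
  using smooth[of z \<theta>s] by (simp add: gF_minimizer)

text \<open>Strong monotonicity against the minimizer, then Cauchy-Schwarz, then division by the
  distance; the division is why \<open>z = \<theta>s\<close> is treated apart.\<close>

lemma norm_dist_minimizer_le: "\<mu> * norm (z - \<theta>s) \<le> norm (gF z)"
proof (cases "z = \<theta>s")
  case False
  have "\<mu> * (norm (z - \<theta>s))\<^sup>2 \<le> gF z \<bullet> (z - \<theta>s)"
    using strong[of z \<theta>s] by (simp add: gF_minimizer)
  also have "\<dots> \<le> norm (gF z) * norm (z - \<theta>s)" by (rule norm_cauchy_schwarz)
  finally show ?thesis using False by (simp add: power2_eq_square)
qed (simp add: gF_minimizer)

text \<open>Trades noise caused by distance from the minimizer for gradient: the step-size cap turns
  \<open>8 * \<eta> * lXi\<^sup>2\<close> into a second factor \<open>\<mu>\<close>, and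
  \<open>\<mu>\<close> times the distance is at most the gradient norm.\<close>

lemma noise_dist_minimizer_le: "8 * m * (lXi\<^sup>2 * (norm (z - \<theta>s))\<^sup>2) \<le> (norm (gF z))\<^sup>2"
proof -
  have "8 * m * (lXi\<^sup>2 * (norm (z - \<theta>s))\<^sup>2) = (8 * \<eta> * lXi\<^sup>2) * \<mu> * (norm (z - \<theta>s))\<^sup>2"
    by simp
  also have "\<dots> \<le> \<mu> * \<mu> * (norm (z - \<theta>s))\<^sup>2"
    using eta_lXi_le mu_pos by (intro mult_right_mono) auto
  also have "\<dots> = (\<mu> * norm (z - \<theta>s))\<^sup>2" by (simp add: power2_eq_square)
  also have "\<dots> \<le> (norm (gF z))\<^sup>2"
    using norm_dist_minimizer_le mu_pos by (intro power_mono) auto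
  finally show ?thesis .
qed

lemma gF_measurable [measurable]: "gF \<in> borel_measurable borel"
proof (rule borel_measurable_continuous_onI)
  have "L-lipschitz_on UNIV gF"
    using smooth L_pos by (intro lipschitz_onI) (auto simp: dist_norm)
  thus "continuous_on UNIV gF" by (rule lipschitz_on_continuous_on)
qed

lemma gf_measurable: "(\<lambda>p. gf (fst p) (snd p)) \<in> borel_measurable (borel \<Otimes>\<^sub>M P)"
  using borel_measurable_gradient[of f P gf] f_grad borel_measurable_integrable[OF f_integrable]
  by (simp add: case_prod_beta)

lemma gf_measurable_compose [measurable (raw)]:
  assumes "h \<in> borel_measurable N" "k \<in> measurable N P"
  shows "(\<lambda>x. gf (h x) (k x)) \<in> borel_measurable N"
  using measurable_compose[OF measurable_Pair[OF assms] gf_measurable] by simp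

lemma noise_measurable_compose [measurable (raw)]:
  assumes [measurable]: "h \<in> borel_measurable N" "k \<in> measurable N P"
  shows "(\<lambda>x. \<epsilon> (h x) (k x)) \<in> borel_measurable N"
  unfolding noise_def by measurable

lemma noise_square_integrable_diff: "square_integrable P (\<lambda>x. \<epsilon> y x - \<epsilon> z x)"
  unfolding square_integrable_def using noise_integrable by auto

lemma noise_at_minimizer: "\<epsilon> \<theta>s x = gf \<theta>s x"
  by (simp add: noise_def gF_minimizer)

lemma integrable_noise: "integrable P (\<epsilon> z)"
  unfolding noise_def[abs_def] using gf_integrable by simp

lemma noise_mean_zero: "(\<integral>x. \<epsilon> z x \<partial>P) = 0"
  unfolding noise_def using gf_integrable gF_eq by (simp add: P.prob_space)

text \<open>At the minimizer the noise is the stochastic gradient, whose second moment is finite.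
  Square integrability of noise differences carries this to every \<open>z\<close>.\<close>

lemma noise_square_integrable: "square_integrable P (\<epsilon> z)"
proof -
  have "square_integrable P (\<epsilon> \<theta>s)"
    unfolding square_integrable_def using sigma_finite by (simp add: noise_at_minimizer)
  from square_integrable_add[OF noise_square_integrable_diff[of z \<theta>s] this] show ?thesis by simp
qed

lemma noise_second_moment: "(\<integral>x. (norm (\<epsilon> z x))\<^sup>2 \<partial>P) \<le> 2 * \<sigma>2 + 2 * lXi\<^sup>2 * (norm (z - \<theta>s))\<^sup>2"
proof -
  have "(\<integral>x. (norm (\<epsilon> z x))\<^sup>2 \<partial>P) \<le> (\<integral>x. 2 * (norm (\<epsilon> z x - \<epsilon> \<theta>s x))\<^sup>2 + 2 * (norm (gf \<theta>s x))\<^sup>2 \<partial>P)"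
  proof (rule integral_mono)
    show "integrable P (\<lambda>x. (norm (\<epsilon> z x))\<^sup>2)"
      using noise_square_integrable by (simp add: square_integrable_def)
    show "integrable P (\<lambda>x. 2 * (norm (\<epsilon> z x - \<epsilon> \<theta>s x))\<^sup>2 + 2 * (norm (gf \<theta>s x))\<^sup>2)"
      using noise_integrable sigma_finite by simp
    show "(norm (\<epsilon> z x))\<^sup>2 \<le> 2 * (norm (\<epsilon> z x - \<epsilon> \<theta>s x))\<^sup>2 + 2 * (norm (gf \<theta>s x))\<^sup>2" for x
      using norm_add_sq_le[of "\<epsilon> z x - \<epsilon> \<theta>s x" "\<epsilon> \<theta>s x"] by (simp add: noise_at_minimizer)
  qed
  also have "\<dots> = 2 * (\<integral>x. (norm (\<epsilon> z x - \<epsilon> \<theta>s x))\<^sup>2 \<partial>P) + 2 * \<sigma>2"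
    using noise_integrable sigma_finite by simp
  also have "\<dots> \<le> 2 * (lXi\<^sup>2 * (norm (z - \<theta>s))\<^sup>2) + 2 * \<sigma>2"
    using noise_lipschitz[of z \<theta>s] by simp
  finally show ?thesis by simp
qed

text \<open>With \<open>k = t\<close> and \<open>y\<close>, \<open>z\<close> the last two iterates,
  this is the centred part of \<open>Suc t\<close> times the new estimator: the noise difference
  enters \<open>t\<close> times and the noise at \<open>y\<close> once more.\<close>

definition step_noise :: "real \<Rightarrow> 'a \<Rightarrow> 'a \<Rightarrow> 'x \<Rightarrow> 'a" where
  "step_noise k y z x = k *\<^sub>R (\<epsilon> y x - \<epsilon> z x) + \<epsilon> y x"

text \<open>What \<open>norm_add_sq_le\<close> and the two noise estimates give for
  \<open>step_noise\<close>. It stays a function of the points because its first term is to be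
  absorbed by the contraction of the drift and its last one by the gradient at
  \<open>y\<close>.\<close>

definition step_variance :: "real \<Rightarrow> 'a \<Rightarrow> 'a \<Rightarrow> real" where
  "step_variance k y z = 2 * k\<^sup>2 * lXi\<^sup>2 * (norm (y - z))\<^sup>2 + 4 * \<sigma>2 + 4 * lXi\<^sup>2 * (norm (y - \<theta>s))\<^sup>2"

lemma step_noise_moments:
  shows "integrable P (step_noise k y z)"
    and "(\<integral>x. step_noise k y z x \<partial>P) = 0"
    and "integrable P (\<lambda>x. (norm (step_noise k y z x))\<^sup>2)"
    and "(\<integral>x. (norm (step_noise k y z x))\<^sup>2 \<partial>P) \<le> step_variance k y z"
proof -
  show "integrable P (step_noise k y z)" "(\<integral>x. step_noise k y z x \<partial>P) = 0"
    unfolding step_noise_def[abs_def] using integrable_noise by (simp_all add: noise_mean_zero)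
  have "square_integrable P (\<lambda>x. step_noise k y z x)"
    unfolding step_noise_def
    by (intro square_integrable_add square_integrable_scaleR noise_square_integrable_diff noise_square_integrable)
  thus sq: "integrable P (\<lambda>x. (norm (step_noise k y z x))\<^sup>2)"
    by (simp add: square_integrable_def)
  have int: "integrable P (\<lambda>x. (norm (\<epsilon> y x))\<^sup>2)"
    using noise_square_integrable by (simp add: square_integrable_def)
  have "(\<integral>x. (norm (step_noise k y z x))\<^sup>2 \<partial>P)
      \<le> (\<integral>x. 2 * k\<^sup>2 * (norm (\<epsilon> y x - \<epsilon> z x))\<^sup>2 + 2 * (norm (\<epsilon> y x))\<^sup>2 \<partial>P)"
  proof (rule integral_mono[OF sq])
    show "integrable P (\<lambda>x. 2 * k\<^sup>2 * (norm (\<epsilon> y x - \<epsilon> z x))\<^sup>2 + 2 * (norm (\<epsilon> y x))\<^sup>2)"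
      using noise_integrable int by simp
    show "(norm (step_noise k y z x))\<^sup>2 \<le> 2 * k\<^sup>2 * (norm (\<epsilon> y x - \<epsilon> z x))\<^sup>2 + 2 * (norm (\<epsilon> y x))\<^sup>2" for x
      unfolding step_noise_def
      using norm_add_sq_le[of "k *\<^sub>R (\<epsilon> y x - \<epsilon> z x)" "\<epsilon> y x"] by (simp add: power_mult_distrib)
  qed
  also have "\<dots> = 2 * k\<^sup>2 * (\<integral>x. (norm (\<epsilon> y x - \<epsilon> z x))\<^sup>2 \<partial>P) + 2 * (\<integral>x. (norm (\<epsilon> y x))\<^sup>2 \<partial>P)"
    using noise_integrable int by simp
  also have "\<dots> \<le> 2 * k\<^sup>2 * (lXi\<^sup>2 * (norm (y - z))\<^sup>2) + 2 * (2 * \<sigma>2 + 2 * lXi\<^sup>2 * (norm (y - \<theta>s))\<^sup>2)"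
    using noise_lipschitz noise_second_moment by (intro add_mono mult_left_mono) auto
  finally show "(\<integral>x. (norm (step_noise k y z x))\<^sup>2 \<partial>P) \<le> step_variance k y z"
    by (simp add: step_variance_def)
qed

text \<open>In the expanded square the cross term is \<open>- 2 * (q / \<eta>)\<close>, and
  co-coercivity with \<open>\<eta> * L \<le> 1 / 4\<close> gives back at most a quarter of
  \<open>q / \<eta>\<close>. Strong monotonicity bounds \<open>q / \<eta>\<close> below by
  \<open>m * (norm u)\<^sup>2\<close>.\<close>

lemma gradient_step_contraction:
  assumes "y - z = - (\<eta> *\<^sub>R u)"
  shows "(norm (u + (gF y - gF z)))\<^sup>2 \<le> (1 - 7 / 4 * m) * (norm u)\<^sup>2"
proof -
  let ?D = "gF y - gF z"
  define q where "q = ?D \<bullet> (y - z)"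
  have q: "q = - \<eta> * (u \<bullet> ?D)" by (simp add: q_def assms inner_commute)
  have "\<mu> * (norm (y - z))\<^sup>2 \<ge> 0" using mu_pos by simp
  hence q0: "q \<ge> 0" using strong[of y z] unfolding q_def by linarith
  have "\<mu> * (\<eta>\<^sup>2 * (norm u)\<^sup>2) \<le> q"
    using strong[of y z] by (simp add: q_def assms power_mult_distrib)
  hence "\<eta> * (m * (norm u)\<^sup>2) \<le> q" by (simp add: power2_eq_square mult_ac)
  hence A: "m * (norm u)\<^sup>2 \<le> q / \<eta>" using eta_pos by (simp add: field_simps)
  have "(norm ?D)\<^sup>2 \<le> L * q"
    unfolding q_def
  proof (rule gradient_cocoercive[OF F_grad smooth _ L_pos])
    show "0 \<le> (gF y - gF z) \<bullet> (y - z)" for y z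
      by (rule order_trans[OF _ strong]) (use mu_pos in simp)
  qed
  also have "\<dots> = (\<eta> * L) * (q / \<eta>)" using eta_pos by simp
  also have "\<dots> \<le> 1 / 4 * (q / \<eta>)"
    using eta_L_le q0 eta_pos by (intro mult_right_mono) auto
  finally have B: "(norm ?D)\<^sup>2 \<le> 1 / 4 * (q / \<eta>)" .
  have "(norm (u + ?D))\<^sup>2 = (norm u)\<^sup>2 + 2 * (u \<bullet> ?D) + (norm ?D)\<^sup>2"
    by (simp add: power2_norm_eq_inner inner_add_left inner_add_right inner_commute)
  moreover have "u \<bullet> ?D = - (q / \<eta>)" using eta_pos q by simp
  ultimately show ?thesis using A B by (simp add: left_diff_distrib)
qed

text \<open>The balance of one step; the factor 4 collects the noise of both second moments, each
  weighted by 2. The contraction frees \<open>5 / 2 * m\<close> of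
  \<open>(norm (k *\<^sub>R u))\<^sup>2\<close> and the noise takes back \<open>m\<close>. The
  gradient term gets \<open>2 + 4 / m\<close> from the weighted square and \<open>2 / m\<close> from
  the noise, at most \<open>13 / (2 * m)\<close> since \<open>m \<le> 1 / 4\<close>.\<close>

lemma potential_step_pointwise:
  assumes "y - z = - (\<eta> *\<^sub>R u)"
  shows "2 * (norm (k *\<^sub>R (u + (gF y - gF z)) + gF y))\<^sup>2 + 2 * (norm (k *\<^sub>R (u - gF z)))\<^sup>2
      + 4 * step_variance k y z
    \<le> 2 * (norm (k *\<^sub>R u))\<^sup>2 + 2 * (norm (k *\<^sub>R (u - gF z)))\<^sup>2 + 16 * \<sigma>2
      + 13 / (2 * m) * (norm (gF y))\<^sup>2"
proof -
  let ?U = "k\<^sup>2 * (norm u)\<^sup>2" and ?G = "(norm (gF y))\<^sup>2"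
  have "(norm (k *\<^sub>R (u + (gF y - gF z)) + gF y))\<^sup>2
      \<le> (1 + m / 2) * (norm (k *\<^sub>R (u + (gF y - gF z))))\<^sup>2 + (1 + 1 / (m / 2)) * ?G"
    \<comment> \<open>The weight \<open>m / 2\<close> is small against the gain
      \<open>7 / 4 * m\<close>, so the product of the two factors stays below
      \<open>1 - 5 / 4 * m\<close>.\<close>
    using m_pos by (intro norm_add_sq_le_weighted) simp
  also have "(norm (k *\<^sub>R (u + (gF y - gF z))))\<^sup>2 = k\<^sup>2 * (norm (u + (gF y - gF z)))\<^sup>2"
    by (simp add: power_mult_distrib)
  also have "(1 + m / 2) * (k\<^sup>2 * (norm (u + (gF y - gF z)))\<^sup>2)
      \<le> (1 + m / 2) * (k\<^sup>2 * ((1 - 7 / 4 * m) * (norm u)\<^sup>2))"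
    using gradient_step_contraction[OF assms] m_pos by (intro mult_left_mono) auto
  also have "\<dots> = (1 - 5 / 4 * m) * ?U - 7 / 8 * (m * m) * ?U" by (simp add: algebra_simps)
  also have "\<dots> \<le> (1 - 5 / 4 * m) * ?U" by simp
  finally have 1: "(norm (k *\<^sub>R (u + (gF y - gF z)) + gF y))\<^sup>2
      \<le> (1 - 5 / 4 * m) * ?U + (1 + 1 / (m / 2)) * ?G" by simp
  have "8 * (lXi\<^sup>2 * (norm (y - z))\<^sup>2) = (8 * \<eta> * lXi\<^sup>2) * (\<eta> * (norm u)\<^sup>2)"
    by (simp add: assms power_mult_distrib power2_eq_square)
  also have "\<dots> \<le> \<mu> * (\<eta> * (norm u)\<^sup>2)"
    using eta_lXi_le eta_pos by (intro mult_right_mono) auto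
  finally have "8 * (lXi\<^sup>2 * (norm (y - z))\<^sup>2) \<le> m * (norm u)\<^sup>2" by (simp add: mult_ac)
  hence "k\<^sup>2 * (8 * (lXi\<^sup>2 * (norm (y - z))\<^sup>2)) \<le> k\<^sup>2 * (m * (norm u)\<^sup>2)"
    by (rule mult_left_mono) simp
  hence 2: "8 * k\<^sup>2 * lXi\<^sup>2 * (norm (y - z))\<^sup>2 \<le> m * ?U" by (simp add: mult_ac)
  have "16 * lXi\<^sup>2 * (norm (y - \<theta>s))\<^sup>2 \<le> 2 / m * ?G"
    using noise_dist_minimizer_le[of y] m_pos by (simp add: field_simps)
  hence "4 * step_variance k y z \<le> m * ?U + 16 * \<sigma>2 + 2 / m * ?G"
    using 2 by (simp add: step_variance_def)
  moreover have "2 * ?G \<le> 1 / (2 * m) * ?G"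
    using m_pos m_le by (intro mult_right_mono) (auto simp: field_simps)
  moreover have "(1 + 1 / (m / 2)) * ?G = ?G + 2 * (1 / m * ?G)" by (simp add: field_simps)
  moreover have "2 / m * ?G = 2 * (1 / m * ?G)" "1 / (2 * m) * ?G = 1 / 2 * (1 / m * ?G)"
    "13 / (2 * m) * ?G = 13 / 2 * (1 / m * ?G)" by simp_all
  moreover have "(1 - 5 / 4 * m) * ?U = ?U - 5 / 4 * (m * ?U)" by (simp add: algebra_simps)
  moreover have "0 \<le> m * ?U" using m_pos by simp
  moreover have "(norm (k *\<^sub>R u))\<^sup>2 = ?U" by (simp add: power_mult_distrib)
  ultimately show ?thesis using 1 by linarith
qed

section \<open>Burn-in, recursion and adaptedness of the iterates\<close>

lemma T0_ge: "24 / m \<le> real T0" and T0_le: "real T0 \<le> 24 / m + 1" and T0_pos: "1 < T0"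
proof -
  \<comment> \<open>The burn-in is long, so \<open>nat\<close> is applied to a positive number and
    \<open>T0 - 1\<close> is a genuine predecessor, at which the iterate is still
    \<open>\<theta>0\<close>.\<close>
  have "96 \<le> 24 / m" using m_pos m_le by (simp add: field_simps)
  thus "24 / m \<le> real T0" "real T0 \<le> 24 / m + 1" unfolding T0_eq by linarith+
  with \<open>96 \<le> 24 / m\<close> show "1 < T0" by linarith
qed

lemma theta_burn_in: "\<omega> \<in> space M \<Longrightarrow> t < T0 \<Longrightarrow> \<theta> t \<omega> = \<theta>0"
  using run[of \<omega>] by (cases "t = 0") (auto simp: root_sgd_def)

lemma v_burn_in:
  "\<omega> \<in> space M \<Longrightarrow> 1 \<le> t \<Longrightarrow> t \<le> T0 \<Longrightarrow> v t \<omega> = (1 / real t) *\<^sub>R (\<Sum>s=1..t. gf \<theta>0 (\<xi> s \<omega>))"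
  using run[of \<omega>] by (auto simp: root_sgd_def)

lemma theta_Suc: "\<omega> \<in> space M \<Longrightarrow> T0 \<le> Suc t \<Longrightarrow> \<theta> (Suc t) \<omega> = \<theta> t \<omega> - \<eta> *\<^sub>R v (Suc t) \<omega>"
  using run[of \<omega>] by (auto simp: root_sgd_def)

lemma v_Suc: "\<omega> \<in> space M \<Longrightarrow> T0 \<le> t \<Longrightarrow>
  v (Suc t) \<omega> = gf (\<theta> t \<omega>) (\<xi> (Suc t) \<omega>)
    + (real t / real (Suc t)) *\<^sub>R (v t \<omega> - gf (\<theta> (t - 1) \<omega>) (\<xi> (Suc t) \<omega>))"
  using run[of \<omega>] by (force simp: root_sgd_def)

text \<open>The offsets cover both uses: \<open>d = 0\<close> for the averaged gradients of the
  burn-in, \<open>d = gF \<theta>0\<close> for sums of noise.\<close>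

lemma past_measurable_sum: "past_measurable t (\<lambda>\<omega>. c + (\<Sum>s=1..t. gf \<theta>0 (\<xi> s \<omega>) - d))"
proof (induction t)
  case (Suc t)
  have "(\<lambda>p. fst p + (gf \<theta>0 (snd p) - d)) \<in> borel_measurable (borel \<Otimes>\<^sub>M P)" by measurable
  from past_measurable_sample[OF Suc this] show ?case by (simp add: add.assoc)
qed (simp add: past_measurable_const)

text \<open>The induction is a strong one because the new estimator looks back two iterates. Within
  a step the estimator comes first, as the new iterate is computed from it. The guard is there
  because the recursion does not determine \<open>v 0\<close>.\<close>

lemma past_measurable_iterates:
  "past_measurable t (\<theta> t) \<and> (1 \<le> t \<longrightarrow> past_measurable t (v t))"
proof (induction t rule: less_induct)
  case (less t)
  have v: "past_measurable t (v t)" if "1 \<le> t"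
  proof (cases "t \<le> T0")
    case True
    have "past_measurable t (\<lambda>\<omega>. (1 / real t) *\<^sub>R (0 + (\<Sum>s=1..t. gf \<theta>0 (\<xi> s \<omega>) - 0)))"
      by (rule past_measurable_compose[OF past_measurable_sum]) measurable
    thus ?thesis
      by (rule past_measurable_cong) (use True that v_burn_in in auto)
  next
    case False
    then obtain k where k: "t = Suc k" "T0 \<le> k" "1 \<le> k" "k - 1 < t" "k < t"
      using T0_pos by (cases t) auto
    have "past_measurable k (\<lambda>\<omega>. (\<theta> k \<omega>, \<theta> (k - 1) \<omega>, v k \<omega>))"
      using less[OF k(5)] past_measurable_mono[of "k - 1" _ k] less[OF k(4)] k(3)
      by (intro past_measurable_Pair) auto
    moreover have "(\<lambda>p. gf (fst (fst p)) (snd p)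
        + (real k / real (Suc k)) *\<^sub>R (snd (snd (fst p)) - gf (fst (snd (fst p))) (snd p)))
      \<in> borel_measurable ((borel :: ('a \<times> 'a \<times> 'a) measure) \<Otimes>\<^sub>M P)"
      unfolding borel_prod[symmetric] by measurable
    ultimately have "past_measurable (Suc k) (\<lambda>\<omega>. gf (\<theta> k \<omega>) (\<xi> (Suc k) \<omega>)
        + (real k / real (Suc k)) *\<^sub>R (v k \<omega> - gf (\<theta> (k - 1) \<omega>) (\<xi> (Suc k) \<omega>)))"
      by (auto dest: past_measurable_sample)
    thus ?thesis unfolding k(1)
      by (rule past_measurable_cong) (use k v_Suc in auto)
  qed
  have "past_measurable t (\<theta> t)"
  proof (cases "t < T0")
    case True
    show ?thesis
      by (rule past_measurable_cong[OF past_measurable_const[of t \<theta>0]]) (use True theta_burn_in in auto)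
  next
    case False
    then obtain k where k: "t = Suc k" using T0_pos by (cases t) auto
    have "past_measurable t (\<lambda>\<omega>. (\<theta> k \<omega>, v t \<omega>))"
      using less[of k] past_measurable_mono[of k _ t] k v by (intro past_measurable_Pair) auto
    moreover have "(\<lambda>p. fst p - \<eta> *\<^sub>R snd p) \<in> borel_measurable (borel :: ('a \<times> 'a) measure)"
      unfolding borel_prod[symmetric] by measurable
    ultimately have "past_measurable t (\<lambda>\<omega>. \<theta> k \<omega> - \<eta> *\<^sub>R v t \<omega>)"
      by (auto dest: past_measurable_compose)
    thus ?thesis
      by (rule past_measurable_cong) (use k False theta_Suc in auto)
  qed
  thus ?case using v by simp
qed

lemma theta_measurable: "\<theta> t \<in> borel_measurable M"
  using past_measurable_iterates past_measurable_borel by blast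

text \<open>The partial sum is a function of the past, so each new sample adds exactly one noise
  variance to the bound. The shift \<open>c\<close> allows for the true gradient contained in the
  estimator.\<close>

lemma noise_sum_second_moment:
  "square_integrable M (\<lambda>\<omega>. c + (\<Sum>s=1..t. \<epsilon> \<theta>0 (\<xi> s \<omega>)))"
  "(\<integral>\<omega>. (norm (c + (\<Sum>s=1..t. \<epsilon> \<theta>0 (\<xi> s \<omega>))))\<^sup>2 \<partial>M)
     \<le> (norm c)\<^sup>2 + real t * (\<integral>x. (norm (\<epsilon> \<theta>0 x))\<^sup>2 \<partial>P)"
proof (induction t)
  case 0
  show "square_integrable M (\<lambda>\<omega>. c + (\<Sum>s=1..0. \<epsilon> \<theta>0 (\<xi> s \<omega>)))"
    by (simp add: square_integrable_const)
  show "(\<integral>\<omega>. (norm (c + (\<Sum>s=1..0. \<epsilon> \<theta>0 (\<xi> s \<omega>))))\<^sup>2 \<partial>M)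
     \<le> (norm c)\<^sup>2 + real 0 * (\<integral>x. (norm (\<epsilon> \<theta>0 x))\<^sup>2 \<partial>P)"
    by (simp add: prob_space)
next
  case (Suc t)
  let ?V = "\<integral>x. (norm (\<epsilon> \<theta>0 x))\<^sup>2 \<partial>P"
  define Y where "Y = (\<lambda>\<omega>. c + (\<Sum>s=1..t. \<epsilon> \<theta>0 (\<xi> s \<omega>)))"
  have past: "past_measurable t Y"
    using past_measurable_sum[of t c "gF \<theta>0"] unfolding Y_def noise_def .
  have meas: "(\<lambda>(y :: 'a, x). \<epsilon> \<theta>0 x) \<in> borel_measurable (borel \<Otimes>\<^sub>M P)"
    by measurable
  have sq: "integrable P (\<lambda>x. (norm (\<epsilon> \<theta>0 x))\<^sup>2)"
    using noise_square_integrable by (simp add: square_integrable_def)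
  have Y_sq: "integrable M (\<lambda>\<omega>. (norm (Y \<omega>))\<^sup>2)"
    using Suc.IH(1) unfolding square_integrable_def Y_def by (rule conjunct2)
  have id: "(\<lambda>y :: 'a. y) \<in> borel_measurable borel" by simp
  have const: "(\<lambda>_ :: 'a. ?V) \<in> borel_measurable borel" by simp
  note inc = second_moment_increment[where Y = Y and t = t and a = "\<lambda>y. y" and e = "\<lambda>_. \<epsilon> \<theta>0"
      and c = "\<lambda>_. ?V", OF past id meas integrable_noise noise_mean_zero sq order_refl const Y_sq integrable_const]
  have eq: "(\<lambda>\<omega>. c + (\<Sum>s=1..Suc t. \<epsilon> \<theta>0 (\<xi> s \<omega>))) = (\<lambda>\<omega>. Y \<omega> + \<epsilon> \<theta>0 (\<xi> (Suc t) \<omega>))"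
    by (simp add: Y_def add.assoc)
  have "past_measurable (Suc t) (\<lambda>\<omega>. c + (\<Sum>s=1..Suc t. \<epsilon> \<theta>0 (\<xi> s \<omega>)))"
    using past_measurable_sum[of "Suc t" c "gF \<theta>0"] unfolding noise_def .
  thus "square_integrable M (\<lambda>\<omega>. c + (\<Sum>s=1..Suc t. \<epsilon> \<theta>0 (\<xi> s \<omega>)))"
    unfolding square_integrable_def eq using inc(1) past_measurable_borel by blast
  have "(\<integral>\<omega>. (norm (c + (\<Sum>s=1..Suc t. \<epsilon> \<theta>0 (\<xi> s \<omega>))))\<^sup>2 \<partial>M)
      = (\<integral>\<omega>. (norm (Y \<omega> + \<epsilon> \<theta>0 (\<xi> (Suc t) \<omega>)))\<^sup>2 \<partial>M)"
    by (simp only: fun_cong[OF eq])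
  also have "\<dots> \<le> (\<integral>\<omega>. (norm (Y \<omega>))\<^sup>2 \<partial>M) + ?V"
    using inc(2) by (simp add: prob_space)
  also have "\<dots> \<le> (norm c)\<^sup>2 + real (Suc t) * ?V"
    using Suc.IH(2) by (simp add: Y_def algebra_simps)
  finally show "(\<integral>\<omega>. (norm (c + (\<Sum>s=1..Suc t. \<epsilon> \<theta>0 (\<xi> s \<omega>))))\<^sup>2 \<partial>M) \<le> (norm c)\<^sup>2 + real (Suc t) * ?V" .
qed

lemma v_T0:
  assumes "\<omega> \<in> space M"
  shows "real T0 *\<^sub>R v T0 \<omega> = real T0 *\<^sub>R gF \<theta>0 + (\<Sum>s=1..T0. \<epsilon> \<theta>0 (\<xi> s \<omega>))"
    and "real T0 *\<^sub>R (v T0 \<omega> - gF \<theta>0) = 0 + (\<Sum>s=1..T0. \<epsilon> \<theta>0 (\<xi> s \<omega>))"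
proof -
  have "real T0 *\<^sub>R v T0 \<omega> = (\<Sum>s=1..T0. gf \<theta>0 (\<xi> s \<omega>))"
    using v_burn_in[OF assms, of T0] T0_pos by simp
  moreover have "(\<Sum>s=1..T0. \<epsilon> \<theta>0 (\<xi> s \<omega>)) = (\<Sum>s=1..T0. gf \<theta>0 (\<xi> s \<omega>)) - real T0 *\<^sub>R gF \<theta>0"
    by (simp add: noise_def sum_subtractf sum_constant_scaleR del: One_nat_def)
  ultimately show "real T0 *\<^sub>R v T0 \<omega> = real T0 *\<^sub>R gF \<theta>0 + (\<Sum>s=1..T0. \<epsilon> \<theta>0 (\<xi> s \<omega>))"
    and "real T0 *\<^sub>R (v T0 \<omega> - gF \<theta>0) = 0 + (\<Sum>s=1..T0. \<epsilon> \<theta>0 (\<xi> s \<omega>))"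
    by (simp_all add: scaleR_diff_right)
qed

text \<open>Multiplying by \<open>Suc t\<close> clears the weight \<open>t / (t + 1)\<close>, and
  every stochastic gradient is split into mean and noise. In the second identity the means cancel,
  so the scaled error changes by centred noise alone: it is a martingale.\<close>

lemma v_Suc_noise:
  assumes "\<omega> \<in> space M" "T0 \<le> t"
  shows "real (Suc t) *\<^sub>R v (Suc t) \<omega>
      = (real t *\<^sub>R (v t \<omega> + (gF (\<theta> t \<omega>) - gF (\<theta> (t - 1) \<omega>))) + gF (\<theta> t \<omega>))
        + step_noise (real t) (\<theta> t \<omega>) (\<theta> (t - 1) \<omega>) (\<xi> (Suc t) \<omega>)"
    and "real (Suc t) *\<^sub>R (v (Suc t) \<omega> - gF (\<theta> t \<omega>))
      = real t *\<^sub>R (v t \<omega> - gF (\<theta> (t - 1) \<omega>))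
        + step_noise (real t) (\<theta> t \<omega>) (\<theta> (t - 1) \<omega>) (\<xi> (Suc t) \<omega>)"
proof -
  have "real (Suc t) *\<^sub>R v (Suc t) \<omega> = real (Suc t) *\<^sub>R gf (\<theta> t \<omega>) (\<xi> (Suc t) \<omega>)
    + real t *\<^sub>R (v t \<omega> - gf (\<theta> (t - 1) \<omega>) (\<xi> (Suc t) \<omega>))"
    unfolding v_Suc[OF assms] scaleR_add_right by simp
  thus "real (Suc t) *\<^sub>R v (Suc t) \<omega>
      = (real t *\<^sub>R (v t \<omega> + (gF (\<theta> t \<omega>) - gF (\<theta> (t - 1) \<omega>))) + gF (\<theta> t \<omega>))
        + step_noise (real t) (\<theta> t \<omega>) (\<theta> (t - 1) \<omega>) (\<xi> (Suc t) \<omega>)"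
    and "real (Suc t) *\<^sub>R (v (Suc t) \<omega> - gF (\<theta> t \<omega>))
      = real t *\<^sub>R (v t \<omega> - gF (\<theta> (t - 1) \<omega>))
        + step_noise (real t) (\<theta> t \<omega>) (\<theta> (t - 1) \<omega>) (\<xi> (Suc t) \<omega>)"
    unfolding step_noise_def noise_def by (simp_all add: algebra_simps)
qed

lemma gF_square_integrable:
  assumes "square_integrable M (\<lambda>\<omega>. \<theta> t \<omega> - \<theta>s)"
  shows "square_integrable M (\<lambda>\<omega>. gF (\<theta> t \<omega>))"
  by (rule square_integrable_bound[OF assms])
     (use theta_measurable norm_gF_le in auto)

text \<open>The general increment bound for the state that determines the next update: two iterates
  and the estimator. The drift \<open>a\<close> is left open because the estimator and its error
  have different drifts but the same noise.\<close>

lemma step_second_moment: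
  fixes a :: "'a \<times> 'a \<times> 'a \<Rightarrow> 'a"
  assumes t: "T0 \<le> t" and a: "a \<in> borel_measurable borel"
    and sq: "square_integrable M (\<lambda>\<omega>. a (\<theta> t \<omega>, \<theta> (t - 1) \<omega>, v t \<omega>))"
    and \<theta>: "square_integrable M (\<lambda>\<omega>. \<theta> t \<omega> - \<theta>s)" "square_integrable M (\<lambda>\<omega>. \<theta> (t - 1) \<omega> - \<theta>s)"
  defines "e \<equiv> \<lambda>\<omega>. step_noise (real t) (\<theta> t \<omega>) (\<theta> (t - 1) \<omega>) (\<xi> (Suc t) \<omega>)"
    and "c \<equiv> \<lambda>\<omega>. step_variance (real t) (\<theta> t \<omega>) (\<theta> (t - 1) \<omega>)"
  shows "integrable M c"
    and "square_integrable M (\<lambda>\<omega>. a (\<theta> t \<omega>, \<theta> (t - 1) \<omega>, v t \<omega>) + e \<omega>)"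
    and "(\<integral>\<omega>. (norm (a (\<theta> t \<omega>, \<theta> (t - 1) \<omega>, v t \<omega>) + e \<omega>))\<^sup>2 \<partial>M)
      \<le> (\<integral>\<omega>. (norm (a (\<theta> t \<omega>, \<theta> (t - 1) \<omega>, v t \<omega>)))\<^sup>2 \<partial>M) + (\<integral>\<omega>. c \<omega> \<partial>M)"
proof -
  let ?Y = "\<lambda>\<omega>. (\<theta> t \<omega>, \<theta> (t - 1) \<omega>, v t \<omega>)"
  have past: "past_measurable t ?Y"
    using past_measurable_iterates[of t] past_measurable_iterates[of "t - 1"]
      past_measurable_mono[of "t - 1" "\<theta> (t - 1)" t] t T0_pos
    by (intro past_measurable_Pair) auto
  have "(\<lambda>p. step_noise (real t) (fst (fst p)) (fst (snd (fst p))) (snd p))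
      \<in> borel_measurable ((borel :: ('a \<times> 'a \<times> 'a) measure) \<Otimes>\<^sub>M P)"
    unfolding borel_prod[symmetric] step_noise_def by measurable
  hence e: "(\<lambda>(y :: 'a \<times> 'a \<times> 'a, x). step_noise (real t) (fst y) (fst (snd y)) x)
      \<in> borel_measurable (borel \<Otimes>\<^sub>M P)"
    by (simp add: case_prod_beta)
  have c: "(\<lambda>y :: 'a \<times> 'a \<times> 'a. step_variance (real t) (fst y) (fst (snd y))) \<in> borel_measurable borel"
    unfolding borel_prod[symmetric] step_variance_def by measurable
  have "square_integrable M (\<lambda>\<omega>. \<theta> t \<omega> - \<theta> (t - 1) \<omega>)"
    using square_integrable_diff[OF \<theta>] by simp
  thus c_int: "integrable M c"
    unfolding c_def step_variance_def using \<theta>(1) by (auto simp: square_integrable_def)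
  have c_int': "integrable M (\<lambda>\<omega>. step_variance (real t) (fst (?Y \<omega>)) (fst (snd (?Y \<omega>))))"
    using c_int by (simp add: c_def)
  have sq': "integrable M (\<lambda>\<omega>. (norm (a (?Y \<omega>)))\<^sup>2)"
    using sq by (simp add: square_integrable_def)
  note inc = second_moment_increment[OF past a e step_noise_moments c sq' c_int']
  show "(\<integral>\<omega>. (norm (a (?Y \<omega>) + e \<omega>))\<^sup>2 \<partial>M) \<le> (\<integral>\<omega>. (norm (a (?Y \<omega>)))\<^sup>2 \<partial>M) + (\<integral>\<omega>. c \<omega> \<partial>M)"
    using inc(2) by (simp add: e_def c_def)
  have [measurable]: "\<theta> t \<in> borel_measurable M" "\<theta> (t - 1) \<in> borel_measurable M"
    "\<xi> (Suc t) \<in> measurable M P" "(\<lambda>\<omega>. a (?Y \<omega>)) \<in> borel_measurable M"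
    using theta_measurable measurable_sample sq by (auto simp: square_integrable_def)
  have "(\<lambda>\<omega>. a (?Y \<omega>) + e \<omega>) \<in> borel_measurable M"
    unfolding e_def step_noise_def by measurable
  thus "square_integrable M (\<lambda>\<omega>. a (?Y \<omega>) + e \<omega>)"
    using inc(1) by (simp add: square_integrable_def e_def)
qed

text \<open>The part of \<open>Suc t\<close> times the new estimator that the past determines, for
  \<open>k = t\<close>; \<open>drift_z\<close> is its analogue for the error. Both act on triples so
  that they fit the increment bound.\<close>

definition drift_v :: "real \<Rightarrow> 'a \<times> 'a \<times> 'a \<Rightarrow> 'a" where
  "drift_v k = (\<lambda>(y, z, u). k *\<^sub>R (u + (gF y - gF z)) + gF y)"

definition drift_z :: "real \<Rightarrow> 'a \<times> 'a \<times> 'a \<Rightarrow> 'a" where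
  "drift_z k = (\<lambda>(y, z, u). k *\<^sub>R (u - gF z))"

lemma drift_measurable: "drift_v k \<in> borel_measurable borel" "drift_z k \<in> borel_measurable borel"
  unfolding drift_v_def drift_z_def case_prod_beta borel_prod[symmetric] by measurable

lemma drift_square_integrable:
  assumes "square_integrable M (v t)" "square_integrable M (\<lambda>\<omega>. \<theta> t \<omega> - \<theta>s)"
    "square_integrable M (\<lambda>\<omega>. \<theta> (t - 1) \<omega> - \<theta>s)"
  shows "square_integrable M (\<lambda>\<omega>. drift_v k (\<theta> t \<omega>, \<theta> (t - 1) \<omega>, v t \<omega>))"
    and "square_integrable M (\<lambda>\<omega>. drift_z k (\<theta> t \<omega>, \<theta> (t - 1) \<omega>, v t \<omega>))"
  unfolding drift_v_def drift_z_def prod.case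
  by (intro square_integrable_add square_integrable_diff square_integrable_scaleR gF_square_integrable assms)+

text \<open>The drift and the noise of a step involve all three vectors, so their integrability is
  carried together. At \<open>T0\<close> the scaled estimator is a constant plus a noise sum, and
  the preceding iterate is \<open>\<theta>0\<close>.\<close>

lemma iterates_square_integrable:
  assumes "T0 \<le> t"
  shows "square_integrable M (v t) \<and> square_integrable M (\<lambda>\<omega>. \<theta> t \<omega> - \<theta>s)
    \<and> square_integrable M (\<lambda>\<omega>. \<theta> (t - 1) \<omega> - \<theta>s)"
  using assms
proof (induction t rule: dec_induct)
  case base
  have "square_integrable M (\<lambda>\<omega>. (1 / real T0) *\<^sub>R (real T0 *\<^sub>R v T0 \<omega>))"
    by (rule square_integrable_scaleR, rule square_integrable_cong[OF noise_sum_second_moment(1)[of "real T0 *\<^sub>R gF \<theta>0" T0]])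
       (rule v_T0(1)[symmetric])
  hence v: "square_integrable M (v T0)" using T0_pos by simp
  have \<theta>': "square_integrable M (\<lambda>\<omega>. \<theta> (T0 - 1) \<omega> - \<theta>s)"
    by (rule square_integrable_cong[OF square_integrable_const[of "\<theta>0 - \<theta>s"]])
       (use theta_burn_in T0_pos in auto)
  have "square_integrable M (\<lambda>\<omega>. (\<theta> (T0 - 1) \<omega> - \<theta>s) - \<eta> *\<^sub>R v T0 \<omega>)"
    by (intro square_integrable_diff square_integrable_scaleR \<theta>' v)
  hence "square_integrable M (\<lambda>\<omega>. \<theta> T0 \<omega> - \<theta>s)"
    by (rule square_integrable_cong) (use theta_Suc[of _ "T0 - 1"] T0_pos in simp)
  thus ?case using v \<theta>' by simp
next
  case (step t)
  from step.IH have "square_integrable M (\<lambda>\<omega>. drift_v (real t) (\<theta> t \<omega>, \<theta> (t - 1) \<omega>, v t \<omega>)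
      + step_noise (real t) (\<theta> t \<omega>) (\<theta> (t - 1) \<omega>) (\<xi> (Suc t) \<omega>))"
    by (intro step_second_moment(2) step.hyps(1) drift_measurable drift_square_integrable) auto
  hence "square_integrable M (\<lambda>\<omega>. real (Suc t) *\<^sub>R v (Suc t) \<omega>)"
    by (rule square_integrable_cong) (simp only: drift_v_def prod.case v_Suc_noise(1)[OF _ step.hyps(1)])
  hence "square_integrable M (\<lambda>\<omega>. (1 / real (Suc t)) *\<^sub>R (real (Suc t) *\<^sub>R v (Suc t) \<omega>))"
    by (rule square_integrable_scaleR)
  hence v: "square_integrable M (v (Suc t))" by simp
  have "square_integrable M (\<lambda>\<omega>. (\<theta> t \<omega> - \<theta>s) - \<eta> *\<^sub>R v (Suc t) \<omega>)"
    by (rule square_integrable_diff[OF _ square_integrable_scaleR[OF v]]) (use step.IH in simp)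
  hence "square_integrable M (\<lambda>\<omega>. \<theta> (Suc t) \<omega> - \<theta>s)"
    by (rule square_integrable_cong) (use theta_Suc[of _ t] step.hyps in simp)
  thus ?case using v step.IH by simp
qed

section \<open>The potential along the run and the final bound\<close>

definition potential :: "nat \<Rightarrow> real" where
  "potential t = 2 * (\<integral>\<omega>. (norm (real t *\<^sub>R v t \<omega>))\<^sup>2 \<partial>M)
     + 2 * (\<integral>\<omega>. (norm (real t *\<^sub>R (v t \<omega> - gF (\<theta> (t - 1) \<omega>))))\<^sup>2 \<partial>M)"

text \<open>Estimator and error carry the same noise sum, with variance at most
  \<open>real T0 * ?V\<close>; the estimator also has the mean \<open>gF \<theta>0\<close>. Bounding
  \<open>?V\<close> through the minimizer leaves multiples of \<open>\<sigma>2\<close> and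
  \<open>?g\<close>.\<close>

lemma potential_T0: "potential T0 \<le> 8 * \<sigma>2 * real T0 + 1900 * (norm (gF \<theta>0))\<^sup>2 / m\<^sup>2"
proof -
  let ?V = "\<integral>x. (norm (\<epsilon> \<theta>0 x))\<^sup>2 \<partial>P" and ?g = "(norm (gF \<theta>0))\<^sup>2"
  have 1: "(\<integral>\<omega>. (norm (real T0 *\<^sub>R v T0 \<omega>))\<^sup>2 \<partial>M) \<le> (norm (real T0 *\<^sub>R gF \<theta>0))\<^sup>2 + real T0 * ?V"
    using noise_sum_second_moment(2)[of "real T0 *\<^sub>R gF \<theta>0" T0]
    by (simp add: v_T0(1) cong: Bochner_Integration.integral_cong)
  have 2: "(\<integral>\<omega>. (norm (real T0 *\<^sub>R (v T0 \<omega> - gF (\<theta> (T0 - 1) \<omega>))))\<^sup>2 \<partial>M) \<le> real T0 * ?V"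
  proof -
    have less: "T0 - 1 < T0" using T0_pos by simp
    have "(\<integral>\<omega>. (norm (real T0 *\<^sub>R (v T0 \<omega> - gF (\<theta> (T0 - 1) \<omega>))))\<^sup>2 \<partial>M)
        = (\<integral>\<omega>. (norm (0 + (\<Sum>s=1..T0. \<epsilon> \<theta>0 (\<xi> s \<omega>))))\<^sup>2 \<partial>M)"
      by (rule Bochner_Integration.integral_cong[OF refl]) (simp only: v_T0(2) theta_burn_in[OF _ less])
    also have "\<dots> \<le> (norm (0::'a))\<^sup>2 + real T0 * ?V" by (rule noise_sum_second_moment(2))
    finally show ?thesis by simp
  qed
  have "2 * lXi\<^sup>2 * (norm (\<theta>0 - \<theta>s))\<^sup>2 \<le> ?g / (4 * m)"
    using noise_dist_minimizer_le[of \<theta>0] m_pos by (simp add: field_simps)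
  hence "?V \<le> 2 * \<sigma>2 + ?g / (4 * m)"
    using noise_second_moment[of \<theta>0] by linarith
  hence "4 * real T0 * ?V \<le> 4 * real T0 * (2 * \<sigma>2 + ?g / (4 * m))"
    by (rule mult_left_mono) simp
  hence "4 * real T0 * ?V \<le> 8 * \<sigma>2 * real T0 + real T0 / m * ?g"
    by (simp add: algebra_simps)
  hence 3: "potential T0 \<le> 8 * \<sigma>2 * real T0 + (2 * (real T0)\<^sup>2 + real T0 / m) * ?g"
    using 1 2 by (simp add: potential_def power_mult_distrib algebra_simps)
  \<comment> \<open>Absorbs the rounding of the ceiling, so \<open>T0\<close> is at most
    \<open>25 / m\<close>. The coefficient of \<open>?g\<close> is then at most
    \<open>1275 / m\<^sup>2\<close>, from \<open>2 * 625 + 25\<close>.\<close>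
  have "1 \<le> 1 / m" using m_pos m_le by simp
  hence T0': "real T0 \<le> 25 / m" using T0_le by linarith
  hence "(real T0)\<^sup>2 \<le> (25 / m)\<^sup>2" by (rule power_mono) simp
  moreover have "real T0 / m \<le> 25 / m / m" using T0' m_pos by (intro divide_right_mono) auto
  ultimately have "2 * (real T0)\<^sup>2 + real T0 / m \<le> 1900 / m\<^sup>2"
    using add_mono[of "2 * (real T0)\<^sup>2" "1250 / m\<^sup>2" "real T0 / m" "25 / m\<^sup>2"]
      divide_right_mono[of 1275 1900 "m\<^sup>2"]
    by (simp add: power_divide power2_eq_square add_divide_distrib[symmetric])
  hence "(2 * (real T0)\<^sup>2 + real T0 / m) * ?g \<le> 1900 / m\<^sup>2 * ?g"
    by (rule mult_right_mono) simp
  thus ?thesis using 3 by simp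
qed

text \<open>Both second moments grow by at most the mean of the same step variance. Integrating the
  pointwise balance bounds the two drifts and four such means at once.\<close>

lemma potential_step:
  assumes t: "T0 \<le> t"
  shows "potential (Suc t) \<le> potential t + 16 * \<sigma>2 + 13 / (2 * m) * (\<integral>\<omega>. (norm (gF (\<theta> t \<omega>)))\<^sup>2 \<partial>M)"
proof -
  let ?Y = "\<lambda>\<omega>. (\<theta> t \<omega>, \<theta> (t - 1) \<omega>, v t \<omega>)"
  let ?c = "\<lambda>\<omega>. step_variance (real t) (\<theta> t \<omega>) (\<theta> (t - 1) \<omega>)"
  note sq = iterates_square_integrable[OF t]
  note v = conjunct1[OF sq] and \<theta> = conjunct1[OF conjunct2[OF sq]] and \<theta>' = conjunct2[OF conjunct2[OF sq]]
  note dv = drift_square_integrable(1)[OF v \<theta> \<theta>', of "real t"]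
    and dz = drift_square_integrable(2)[OF v \<theta> \<theta>', of "real t"]
  note sv = step_second_moment[OF t drift_measurable(1) dv \<theta> \<theta>']
    and sz = step_second_moment[OF t drift_measurable(2) dz \<theta> \<theta>']
  have ints: "integrable M (\<lambda>\<omega>. (norm (drift_v (real t) (?Y \<omega>)))\<^sup>2)" "integrable M (\<lambda>\<omega>. (norm (drift_z (real t) (?Y \<omega>)))\<^sup>2)"
    "integrable M ?c" "integrable M (\<lambda>\<omega>. (norm (real t *\<^sub>R v t \<omega>))\<^sup>2)" "integrable M (\<lambda>\<omega>. (norm (gF (\<theta> t \<omega>)))\<^sup>2)"
    using dv dz sv(1) square_integrable_scaleR[OF v, of "real t"] gF_square_integrable[OF \<theta>]
    unfolding square_integrable_def by blast+
  have V: "(\<integral>\<omega>. (norm (real (Suc t) *\<^sub>R v (Suc t) \<omega>))\<^sup>2 \<partial>M)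
      \<le> (\<integral>\<omega>. (norm (drift_v (real t) (?Y \<omega>)))\<^sup>2 \<partial>M) + (\<integral>\<omega>. ?c \<omega> \<partial>M)"
    using sv(3) t by (simp only: v_Suc_noise(1) drift_v_def prod.case cong: Bochner_Integration.integral_cong)
  have Z: "(\<integral>\<omega>. (norm (real (Suc t) *\<^sub>R (v (Suc t) \<omega> - gF (\<theta> t \<omega>))))\<^sup>2 \<partial>M)
      \<le> (\<integral>\<omega>. (norm (drift_z (real t) (?Y \<omega>)))\<^sup>2 \<partial>M) + (\<integral>\<omega>. ?c \<omega> \<partial>M)"
    using sz(3) t by (simp only: v_Suc_noise(2) drift_z_def prod.case cong: Bochner_Integration.integral_cong)
  have "(\<integral>\<omega>. 2 * (norm (drift_v (real t) (?Y \<omega>)))\<^sup>2 + 2 * (norm (drift_z (real t) (?Y \<omega>)))\<^sup>2 + 4 * ?c \<omega> \<partial>M)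
     \<le> (\<integral>\<omega>. 2 * (norm (real t *\<^sub>R v t \<omega>))\<^sup>2 + 2 * (norm (drift_z (real t) (?Y \<omega>)))\<^sup>2 + 16 * \<sigma>2
          + 13 / (2 * m) * (norm (gF (\<theta> t \<omega>)))\<^sup>2 \<partial>M)"
  proof (rule integral_mono)
    fix \<omega> assume "\<omega> \<in> space M"
    \<comment> \<open>This holds already at \<open>t = T0\<close>: the first move leads from
      \<open>\<theta> (T0 - 1)\<close> to \<open>\<theta> T0\<close>.\<close>
    hence "\<theta> t \<omega> - \<theta> (t - 1) \<omega> = - (\<eta> *\<^sub>R v t \<omega>)"
      using theta_Suc[of \<omega> "t - 1"] t T0_pos by simp
    from potential_step_pointwise[OF this, of "real t"]
    show "2 * (norm (drift_v (real t) (?Y \<omega>)))\<^sup>2 + 2 * (norm (drift_z (real t) (?Y \<omega>)))\<^sup>2 + 4 * ?c \<omega>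
      \<le> 2 * (norm (real t *\<^sub>R v t \<omega>))\<^sup>2 + 2 * (norm (drift_z (real t) (?Y \<omega>)))\<^sup>2 + 16 * \<sigma>2
          + 13 / (2 * m) * (norm (gF (\<theta> t \<omega>)))\<^sup>2"
      by (simp only: drift_v_def drift_z_def prod.case)
  qed (intro Bochner_Integration.integrable_add integrable_mult_right ints integrable_const)+
  hence "2 * (\<integral>\<omega>. (norm (drift_v (real t) (?Y \<omega>)))\<^sup>2 \<partial>M) + 2 * (\<integral>\<omega>. (norm (drift_z (real t) (?Y \<omega>)))\<^sup>2 \<partial>M)
      + 4 * (\<integral>\<omega>. ?c \<omega> \<partial>M)
    \<le> 2 * (\<integral>\<omega>. (norm (real t *\<^sub>R v t \<omega>))\<^sup>2 \<partial>M) + 2 * (\<integral>\<omega>. (norm (drift_z (real t) (?Y \<omega>)))\<^sup>2 \<partial>M) + 16 * \<sigma>2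
          + 13 / (2 * m) * (\<integral>\<omega>. (norm (gF (\<theta> t \<omega>)))\<^sup>2 \<partial>M)"
    using ints by (simp del: norm_scaleR add: prob_space)
  thus ?thesis
    using V Z unfolding potential_def diff_Suc_1 drift_z_def prod.case by linarith
qed

text \<open>The scaled gradient is the difference of the two vectors in the potential, and the
  factors 2 there are those of \<open>norm_add_sq_le\<close>.\<close>

lemma gradient_le_potential:
  assumes t: "T0 \<le> t"
  shows "(real (Suc t))\<^sup>2 * (\<integral>\<omega>. (norm (gF (\<theta> t \<omega>)))\<^sup>2 \<partial>M) \<le> potential (Suc t)"
proof -
  let ?n = "real (Suc t)"
  have v: "square_integrable M (v (Suc t))" and \<theta>: "square_integrable M (\<lambda>\<omega>. \<theta> t \<omega> - \<theta>s)"
    using iterates_square_integrable[of "Suc t"] t by auto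
  note g = gF_square_integrable[OF \<theta>]
  have 1: "integrable M (\<lambda>\<omega>. (norm (gF (\<theta> t \<omega>)))\<^sup>2)"
    and 2: "integrable M (\<lambda>\<omega>. (norm (?n *\<^sub>R v (Suc t) \<omega>))\<^sup>2)"
    and 3: "integrable M (\<lambda>\<omega>. (norm (?n *\<^sub>R (v (Suc t) \<omega> - gF (\<theta> t \<omega>))))\<^sup>2)"
    using g square_integrable_scaleR[OF v, of ?n]
      square_integrable_scaleR[OF square_integrable_diff[OF v g], of ?n]
    unfolding square_integrable_def by blast+
  have "(\<integral>\<omega>. ?n\<^sup>2 * (norm (gF (\<theta> t \<omega>)))\<^sup>2 \<partial>M)
    \<le> (\<integral>\<omega>. 2 * (norm (?n *\<^sub>R v (Suc t) \<omega>))\<^sup>2 + 2 * (norm (?n *\<^sub>R (v (Suc t) \<omega> - gF (\<theta> t \<omega>))))\<^sup>2 \<partial>M)"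
  proof (rule integral_mono)
    fix \<omega>
    have "?n\<^sup>2 * (norm (gF (\<theta> t \<omega>)))\<^sup>2
        = (norm (?n *\<^sub>R v (Suc t) \<omega> + - (?n *\<^sub>R (v (Suc t) \<omega> - gF (\<theta> t \<omega>)))))\<^sup>2"
      by (simp add: scaleR_diff_right power_mult_distrib)
    also have "\<dots> \<le> 2 * (norm (?n *\<^sub>R v (Suc t) \<omega>))\<^sup>2 + 2 * (norm (- (?n *\<^sub>R (v (Suc t) \<omega> - gF (\<theta> t \<omega>)))))\<^sup>2"
      by (rule norm_add_sq_le)
    finally show "?n\<^sup>2 * (norm (gF (\<theta> t \<omega>)))\<^sup>2
      \<le> 2 * (norm (?n *\<^sub>R v (Suc t) \<omega>))\<^sup>2 + 2 * (norm (?n *\<^sub>R (v (Suc t) \<omega> - gF (\<theta> t \<omega>))))\<^sup>2"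
      by (simp only: norm_minus_cancel)
  qed (intro Bochner_Integration.integrable_add integrable_mult_right 1 2 3)+
  thus ?thesis
    using 2 3 unfolding potential_def by (simp del: norm_scaleR of_nat_Suc)
qed

text \<open>During the burn-in the gradient is the initial one and the second term alone suffices.
  Afterwards the potential bound is divided by the square of the time.\<close>

lemma gradient_bound:
  assumes "T \<ge> 1"
  shows "integrable M (\<lambda>\<omega>. (norm (gF (\<theta> T \<omega>)))\<^sup>2)"
    and "(\<integral>\<omega>. (norm (gF (\<theta> T \<omega>)))\<^sup>2 \<partial>M)
      \<le> 28 * \<sigma>2 / real T + 2700 * (norm (gF \<theta>0))\<^sup>2 / (\<eta>\<^sup>2 * \<mu>\<^sup>2 * (real T)\<^sup>2)"
proof -
  let ?g = "(norm (gF \<theta>0))\<^sup>2"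
  have s0: "0 \<le> \<sigma>2" by simp
  have T: "real T > 0" using assms by simp
  have "integrable M (\<lambda>\<omega>. (norm (gF (\<theta> T \<omega>)))\<^sup>2) \<and> (\<integral>\<omega>. (norm (gF (\<theta> T \<omega>)))\<^sup>2 \<partial>M)
      \<le> 28 * \<sigma>2 / real T + 2700 * ?g / (m * real T)\<^sup>2"
  proof (cases "T < T0")
    case True
    have int: "integrable M (\<lambda>\<omega>. (norm (gF (\<theta> T \<omega>)))\<^sup>2)"
      using theta_burn_in True by (simp cong: Bochner_Integration.integrable_cong)
    have eq: "(\<integral>\<omega>. (norm (gF (\<theta> T \<omega>)))\<^sup>2 \<partial>M) = ?g"
      using theta_burn_in True by (simp add: prob_space cong: Bochner_Integration.integral_cong)
    \<comment> \<open>Strictness of \<open>T < T0\<close> cancels the rounding of the ceiling. It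
      remains that the square of 24, which is 576, is below 2700.\<close>
    have "real T \<le> 24 / m" using T0_le True by linarith
    hence "m * real T \<le> 24" using m_pos by (simp add: field_simps)
    hence "(m * real T)\<^sup>2 \<le> 24\<^sup>2" using m_pos T by (intro power_mono) auto
    hence "?g * (m * real T)\<^sup>2 \<le> ?g * 2700" by (intro mult_left_mono) auto
    moreover have "0 < (m * real T)\<^sup>2" by (rule zero_less_power[OF mult_pos_pos[OF m_pos T]])
    ultimately have "?g \<le> 2700 * ?g / (m * real T)\<^sup>2"
      by (simp only: pos_le_divide_eq mult.commute[of 2700])
    moreover have "0 \<le> 28 * \<sigma>2 / real T" using s0 by simp
    ultimately show ?thesis using int unfolding eq by linarith
  next
    case False
    hence t: "T0 \<le> T" by simp
    let ?n = "real (Suc T)" and ?E = "\<integral>\<omega>. (norm (gF (\<theta> T \<omega>)))\<^sup>2 \<partial>M"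
    have int: "integrable M (\<lambda>\<omega>. (norm (gF (\<theta> T \<omega>)))\<^sup>2)"
      using gF_square_integrable iterates_square_integrable[OF t] by (auto simp: square_integrable_def)
    \<comment> \<open>The index is \<open>Suc T\<close> because the estimator that tracks the
      gradient at \<open>\<theta> T\<close> is the next one.\<close>
    have "potential (Suc T) \<le> 28 * \<sigma>2 * ?n + (2700 - 17550 / (m * ?n)) * ?g / m\<^sup>2"
      using t by (intro potential_bound[OF m_pos m_le s0 _ T0_ge potential_T0 potential_step gradient_le_potential]) simp_all
    also have "\<dots> \<le> 28 * \<sigma>2 * ?n + 2700 * ?g / m\<^sup>2"
      using m_pos by (intro add_left_mono divide_right_mono mult_right_mono) auto
    finally have "?n\<^sup>2 * ?E \<le> 28 * \<sigma>2 * ?n + 2700 * ?g / m\<^sup>2"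
      using gradient_le_potential[OF t] by linarith
    hence "?E \<le> (28 * \<sigma>2 * ?n + 2700 * ?g / m\<^sup>2) / ?n\<^sup>2"
      by (simp add: pos_le_divide_eq mult.commute del: of_nat_Suc)
    also have "\<dots> = 28 * \<sigma>2 / ?n + 2700 * ?g / (m * ?n)\<^sup>2"
      by (simp add: add_divide_distrib power_mult_distrib del: of_nat_Suc) (simp add: power2_eq_square)
    \<comment> \<open>Passing from \<open>T + 1\<close> back to \<open>T\<close> only enlarges both
      terms.\<close>
    also have "\<dots> \<le> 28 * \<sigma>2 / real T + 2700 * ?g / (m * real T)\<^sup>2"
      using s0 T eta_pos mu_pos by (intro add_mono divide_left_mono power_mono mult_left_mono mult_pos_pos zero_less_power) auto
    finally show ?thesis using int by simp
  qed
  thus "integrable M (\<lambda>\<omega>. (norm (gF (\<theta> T \<omega>)))\<^sup>2)"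
    and "(\<integral>\<omega>. (norm (gF (\<theta> T \<omega>)))\<^sup>2 \<partial>M)
      \<le> 28 * \<sigma>2 / real T + 2700 * ?g / (\<eta>\<^sup>2 * \<mu>\<^sup>2 * (real T)\<^sup>2)"
    by (simp_all add: power_mult_distrib)
qed

end

theorem theorem1:
  fixes P :: "'x measure"
    and f :: "real^'d \<Rightarrow> 'x \<Rightarrow> real"
    and gf :: "real^'d \<Rightarrow> 'x \<Rightarrow> real^'d"
    and gF :: "real^'d \<Rightarrow> real^'d"
    and \<theta>s \<theta>0 :: "real^'d"
    and \<mu> L lXi \<eta> :: real
    and M :: "'w measure"
    and \<xi> :: "nat \<Rightarrow> 'w \<Rightarrow> 'x"
    and \<theta> v :: "nat \<Rightarrow> 'w \<Rightarrow> real^'d"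
    and T0 T :: nat
  assumes "prob_space P"
    and f_integrable: "\<And>z. integrable P (f z)"
    and f_grad: "\<And>z x. x \<in> space P \<Longrightarrow> GDERIV (\<lambda>y. f y x) z :> gf z x"
    and F_grad: "\<And>z. GDERIV (risk P f) z :> gF z"
    and gf_integrable: "\<And>z. integrable P (gf z)"
    and gF_eq: "\<And>z. gF z = (\<integral>x. gf z x \<partial>P)"
    and "prob_space M"
    and \<xi>_indep: "prob_space.indep_vars M (\<lambda>_. P) \<xi> {1..}"
    and \<xi>_distr: "\<And>t. t \<ge> 1 \<Longrightarrow> distr M P (\<xi> t) = P"
    and C2: "twice_continuously_differentiable (risk P f)"
    and "0 < \<mu>" and "\<mu> \<le> L"
    and smooth: "\<And>y z. norm (gF y - gF z) \<le> L * norm (y - z)"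
    and strong: "\<And>y z. (gF y - gF z) \<bullet> (y - z) \<ge> \<mu> * (norm (y - z))\<^sup>2"
    and minimizer: "\<And>z. risk P f \<theta>s \<le> risk P f z"
    and \<sigma>_finite: "integrable P (\<lambda>x. (norm (gf \<theta>s x))\<^sup>2)"
    and \<Sigma>_pos_def: "positive_definite (\<integral>x. outer_product (gf \<theta>s x) (gf \<theta>s x) \<partial>P)"
    and "0 < lXi"
    and noise_integrable:
      "\<And>y z. integrable P (\<lambda>x. (norm (noise gf gF y x - noise gf gF z x))\<^sup>2)"
    and noise_lipschitz:
      "\<And>y z. (\<integral>x. (norm (noise gf gF y x - noise gf gF z x))\<^sup>2 \<partial>P)
              \<le> lXi\<^sup>2 * (norm (y - z))\<^sup>2"
    and "0 < \<eta>" and "\<eta> \<le> min (1 / (4 * L)) (\<mu> / (8 * lXi\<^sup>2))"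
    and T0_eq: "T0 = nat \<lceil>24 / (\<eta> * \<mu>)\<rceil>"
    and run: "\<And>\<omega>. \<omega> \<in> space M \<Longrightarrow>
      root_sgd gf \<eta> T0 \<theta>0 (\<lambda>t. \<xi> t \<omega>) (\<lambda>t. \<theta> t \<omega>) (\<lambda>t. v t \<omega>)"
    and "T \<ge> 1"
  shows "integrable M (\<lambda>\<omega>. (norm (gF (\<theta> T \<omega>)))\<^sup>2) \<and>
    (\<integral>\<omega>. (norm (gF (\<theta> T \<omega>)))\<^sup>2 \<partial>M)
      \<le> 28 * (\<integral>x. (norm (gf \<theta>s x))\<^sup>2 \<partial>P) / real T
        + 2700 * (norm (gF \<theta>0))\<^sup>2 / (\<eta>\<^sup>2 * \<mu>\<^sup>2 * (real T)\<^sup>2)"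
proof -
  have "root_sgd_run M P \<xi> f gf gF \<theta>s \<theta>0 \<mu> L lXi \<eta> \<theta> v T0"
    by (intro root_sgd_run.intro iid_samples.intro iid_samples_axioms.intro root_sgd_run_axioms.intro)
       (fact assms)+
  from root_sgd_run.gradient_bound[OF this \<open>T \<ge> 1\<close>] show ?thesis by blast
qed

end
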